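(* Let $A \in M_n(\mathbb Z)$ be an integral matrix with non-zero determinant and let $f_A(x) = \det(x1-A)$ be its characteristic polynomial. Write $$f_A(x) = (1-x)^k g(x),$$ where $k \in \{0,1,\dots,n\}$ is the algebraic multiplicity of $1$ as a root of $f_A$. 1) If no unimodular polynomial divides $f_A$, then every affine local homeomorphism of $\mathbb T^n$ with $\phi_A$ as linear part is exact and conjugate to $\phi_A$. 2) Suppose $k \ge 1$ but no unimodular polynomial divides $g$. Let $S$ be the set of elements $\mu \in \mathbb T^n$ with the property that the closed subgroup of $\mathbb T^n$ generated by $\mu$ and $$\left\{ x^{-1}\phi_A(x) : x \in \mathbb T^n\right\}$$ is all of $\mathbb T^n$. Then $S$ is a dense proper subset of $\mathbb T^n$ such that, for $\lambda \in \mathbb T^n$, the affine map $Tx = \lambda \phi_A(x)$ is strongly transitive if and only if $\lambda \in S$. In this case no affine local homeomorphism with $\phi_A$ as linear part is exact. 3) If there is a unimodular polynomial which divides $g$, then no affine local homeomorphism of $\mathbb T^n$ with $\phi_A$ as linear part is strongly transitive.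
   Context: For $A=(a_{ij}) \in M_n(\mathbb Z)$, $\phi_A : \mathbb T^n \to \mathbb T^n$ is the continuous group endomorphism whose $i$-th coordinate is $\phi_A(t_1,\dots,t_n)_i = t_1^{a_{i1}}t_2^{a_{i2}}\cdots t_n^{a_{in}}$. An affine map of $\mathbb T^n$ with linear part $\phi_A$ is a map $Tx = \lambda\phi_A(x)$ with $\lambda \in \mathbb T^n$; it is a local homeomorphism if and only if $\det A \ne 0$. A non-constant polynomial $a_kx^k + a_{k-1}x^{k-1} + \dots + a_0$ is unimodular when all $a_i \in \mathbb Z$, $a_k = 1$ and $a_0 \in \{-1,1\}$. A continuous map $\psi: X \to X$ on a compact metric space is strongly transitive when for every open non-empty $V \subseteq X$ there is $N \in \mathbb N$ with $\bigcup_{i=0}^N \psi^i(V) = X$; it is exact when for every open non-empty $V \subseteq X$ there is $N \in \mathbb N$ with $\psi^N(V) = X$. Two maps $S,T$ of $\mathbb T^n$ are conjugate when $S = hTh^{-1}$ for some homeomorphism $h$ of $\mathbb T^n$. *)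

theory Defs
  imports
    "HOL-Analysis.Analysis"
    "HOL-Computational_Algebra.Computational_Algebra"
    "HOL-Algebra.Group"
begin

(* T^n is the set of vectors in C^n all of whose coordinates have modulus 1. It carries the
   subspace topology and coordinatewise multiplication; n = CARD('n) >= 1 is arbitrary. *)

definition torus :: "(complex^'n) set" where
  "torus = {x. \<forall>i. norm (x $ i) = 1}"

definition torus_group :: "(complex^'n) monoid" where
  "torus_group = \<lparr>carrier = torus, mult = (\<lambda>x y. \<chi> i. x $ i * y $ i), one = (\<chi> i. 1)\<rparr>"

definition torus_endo :: "int^'n^'n \<Rightarrow> complex^'n \<Rightarrow> complex^'n" where
  "torus_endo A t = (\<chi> i. \<Prod>j\<in>UNIV. (t $ j) powi (A $ i $ j))"

(* Maps of T^n are functions on all of C^n of which only the values on torus matter. *)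

definition affine_map_of :: "int^'n^'n \<Rightarrow> (complex^'n \<Rightarrow> complex^'n) \<Rightarrow> bool" where
  "affine_map_of A T \<longleftrightarrow>
     (\<exists>\<mu>\<in>torus. \<forall>x\<in>torus. T x = \<mu> \<otimes>\<^bsub>torus_group\<^esub> torus_endo A x)"

definition closed_subgroup_generated :: "(complex^'n) set \<Rightarrow> (complex^'n) set" where
  "closed_subgroup_generated M =
     \<Inter>{H. subgroup H torus_group \<and> closedin (top_of_set torus) H \<and> M \<subseteq> H}"

definition charpoly :: "int^'n^'n \<Rightarrow> int poly" where
  "charpoly A = det (mat [:0, 1:] - (\<chi> i j. [:A $ i $ j:]))"

definition unimodular_poly :: "int poly \<Rightarrow> bool" where
  "unimodular_poly p \<longleftrightarrow> degree p > 0 \<and> lead_coeff p = 1 \<and> coeff p 0 \<in> {-1, 1}"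

definition local_homeomorphism_on :: "'a::topological_space set \<Rightarrow> ('a \<Rightarrow> 'a) \<Rightarrow> bool" where
  "local_homeomorphism_on X f \<longleftrightarrow> f ` X \<subseteq> X \<and>
     (\<forall>x\<in>X. \<exists>U. x \<in> U \<and> openin (top_of_set X) U \<and> openin (top_of_set X) (f ` U) \<and>
        (\<exists>h. homeomorphism U (f ` U) f h))"

definition strongly_transitive_on :: "'a::metric_space set \<Rightarrow> ('a \<Rightarrow> 'a) \<Rightarrow> bool" where
  "strongly_transitive_on X f \<longleftrightarrow>
     (\<forall>V. openin (top_of_set X) V \<and> V \<noteq> {} \<longrightarrow> (\<exists>N::nat. (\<Union>i\<le>N. (f ^^ i) ` V) = X))"

definition exact_on :: "'a::metric_space set \<Rightarrow> ('a \<Rightarrow> 'a) \<Rightarrow> bool" where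
  "exact_on X f \<longleftrightarrow>
     (\<forall>V. openin (top_of_set X) V \<and> V \<noteq> {} \<longrightarrow> (\<exists>N::nat. (f ^^ N) ` V = X))"

definition conjugate_on :: "'a::topological_space set \<Rightarrow> ('a \<Rightarrow> 'a) \<Rightarrow> ('a \<Rightarrow> 'a) \<Rightarrow> bool" where
  "conjugate_on X S T \<longleftrightarrow>
     (\<exists>h h'. homeomorphism X X h h' \<and> (\<forall>x\<in>X. S x = h (T (h' x))))"

lemma comm_group_torus_group: "comm_group (torus_group :: (complex^'n) monoid)"
proof (rule comm_groupI)
  fix x :: "complex^'n"
  assume "x \<in> carrier torus_group"
  then have x: "norm (x $ i) = 1" for i
    by (simp add: torus_group_def torus_def)
  then have "x $ i \<noteq> 0" for i
    by (metis norm_zero zero_neq_one)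
  then have "(\<chi> i. inverse (x $ i)) \<in> carrier torus_group \<and>
      (\<chi> i. inverse (x $ i)) \<otimes>\<^bsub>torus_group\<^esub> x = \<one>\<^bsub>torus_group\<^esub>"
    using x by (simp add: torus_group_def torus_def norm_inverse)
  then show "\<exists>y\<in>carrier torus_group. y \<otimes>\<^bsub>torus_group\<^esub> x = \<one>\<^bsub>torus_group\<^esub>"
    by blast
qed (auto simp: torus_group_def torus_def norm_mult vec_eq_iff mult_ac)

lemma torus_endo_in_torus: "x \<in> torus \<Longrightarrow> torus_endo A x \<in> torus"
  by (simp add: torus_def torus_endo_def prod_norm [symmetric] norm_power_int)

end

theory Submission
  imports Defs
begin

text \<open>Every point of the torus is \<open>tor x\<close> for some real vector \<open>x\<close>, and an affine map with linear part
\<open>A\<close> lifts to \<open>x \<mapsto> A x + l\<close>. The characters of the torus are \<open>x \<mapsto> e(m \<bullet> x)\<close> for integer vectors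
\<open>m\<close>, where \<open>e(t) = exp(2 \<pi> i t)\<close>; composing with \<open>A\<close> turns \<open>m\<close> into \<open>B m\<close>, where \<open>B\<close> is the
transpose of \<open>A\<close>. All three parts of the theorem come from one question: how do the characters
distribute over the sets of preimages \<open>T\<^sup>-\<^sup>i y\<close>?

Density is deduced from averages. A product of powers of \<open>(1 + cos 2 \<pi> x) / 2\<close> is a trigonometric
polynomial concentrated at the origin, so there is a finite set of nonzero characters such that
every finite family of points along which these characters have small averages meets a prescribed
box (\<open>trig_poly_concentration\<close>). To produce such families one adds multiples of points at which a
given character is nontrivial, which makes geometric sums (\<open>group_average_small\<close>), or one uses a
long piece of a backward orbit, along which a character on which \<open>B\<close> acts unipotently has a
polynomial phase; Weyl's theorem, proved by van der Corput's inequality, then applies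
(\<open>Weyl_average_tendsto_0\<close>).

A character \<open>m\<close> is trivial on all iterated preimages of the identity iff \<open>m\<close> can be divided by \<open>B\<close>
arbitrarily often inside the integer vectors. Noetherianity of the integer lattice then gives an integer
polynomial \<open>s\<close> with \<open>s(0) = 1\<close> and \<open>s(B) m = 0\<close>. If \<open>(B - 1)\<^sup>r m\<close> never vanishes, some root of
\<open>s\<close> other than 1 is an eigenvalue of \<open>A\<close>, and its primitive integer minimal polynomial divides both \<open>s\<close> and
\<open>g\<close>; up to sign it is unimodular (\<open>unimodular_factor_from_annihilator\<close>). Hence, if no unimodular
polynomial divides \<open>g\<close>, every character either is detected by preimages of the identity or is unipotent for \<open>B\<close>
(\<open>divisible_imp_unipotent\<close>).

In part 1 the number 1 is not an eigenvalue, so every nontrivial character is detected, the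
preimages of the identity under some iterate are as dense as desired, and the map is exact; conjugacy
holds because \<open>1 - A\<close> is invertible over the reals. In part 2 the closed subgroup condition on
\<open>\<lambda>\<close> says that no nontrivial character with \<open>B m = m\<close> is trivial at \<open>\<lambda>\<close>. If such a character
exists, it is invariant under the map and obstructs strong transitivity. Otherwise the leading
coefficients of all unipotent phases are irrational, backward orbits are dense, and
compactness gives strong transitivity. Since 1 is an eigenvalue, there is a nonzero \<open>m\<close> with
\<open>B m = m\<close>: the map permutes the level sets of the corresponding character, so it is not exact, and \<open>\<lambda> = 1\<close> is not
admissible; the admissible \<open>\<lambda>\<close> avoid countably many affine hyperplanes and are dense. In part 3 the
integer vectors killed by \<open>p(B)\<close>, for a unimodular divisor \<open>p\<close> of \<open>g\<close>, form a lattice on which \<open>B\<close> is invertible and 1 is not an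
eigenvalue. The corresponding quotient of the map is invertible and has a fixed point, and a point above
that fixed point has a backward orbit that stays in a proper closed subset.\<close>

no_notation fps_nth (infixl \<open>$\<close> 75)


section \<open>The exponential and integer characters\<close>

text \<open>The standard additive character \<open>e(t) = exp(2 \<pi> i t)\<close> of the reals.\<close>

definition ec :: "real \<Rightarrow> complex" where
  "ec t = cis (2 * pi * t)"

lemma ec_add: "ec (s + t) = ec s * ec t"
  by (simp add: ec_def cis_mult distrib_left)

lemma ec_0 [simp]: "ec 0 = 1"
  by (simp add: ec_def)

lemma norm_ec [simp]: "norm (ec t) = 1"
  by (simp add: ec_def)

lemma ec_nonzero [simp]: "ec t \<noteq> 0"
  by (metis norm_ec norm_zero zero_neq_one)

lemma ec_minus: "ec (- t) = cnj (ec t)"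
  by (simp add: ec_def cis_cnj)

lemma ec_diff: "ec (s - t) = ec s * cnj (ec t)"
  using ec_add[of s "- t"] by (simp add: ec_minus)

lemma ec_sum: "ec (\<Sum>i\<in>I. f i) = (\<Prod>i\<in>I. ec (f i))"
  by (induction I rule: infinite_finite_induct) (auto simp: ec_add)

lemma ec_of_nat_mult: "ec (of_nat n * t) = ec t ^ n"
  by (induction n) (auto simp: ec_add distrib_right)

lemma ec_powi: "ec t powi k = ec (of_int k * t)"
  by (simp add: ec_def cis_power_int mult_ac)

lemma ec_eq_1_iff: "ec t = 1 \<longleftrightarrow> t \<in> \<int>"
proof -
  have "ec t = 1 \<longleftrightarrow> cos (2 * pi * t) = 1"
    by (auto simp: ec_def complex_eq_iff intro: cos_one_sin_zero)
  also have "\<dots> \<longleftrightarrow> (\<exists>x::int. 2 * pi * t = of_int x * 2 * pi)"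
    by (simp add: cos_one_2pi_int)
  also have "\<dots> \<longleftrightarrow> t \<in> \<int>"
    by (auto simp: Ints_def mult_ac)
  finally show ?thesis .
qed

lemma ec_eq_iff: "ec s = ec t \<longleftrightarrow> s - t \<in> \<int>"
proof -
  have "ec s = ec (s - t) * ec t"
    using ec_add[of "s - t" t] by simp
  then have "ec s = ec t \<longleftrightarrow> ec (s - t) = 1"
    by simp
  then show ?thesis by (simp add: ec_eq_1_iff)
qed

lemma continuous_on_ec [continuous_intros]:
  "continuous_on S f \<Longrightarrow> continuous_on S (\<lambda>x. ec (f x))"
  unfolding ec_def by (intro continuous_intros)

definition dot :: "int^'n \<Rightarrow> real^'n \<Rightarrow> real" where
  "dot m x = (\<Sum>i\<in>UNIV. of_int (m $ i) * x $ i)"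

lemma dot_add: "dot m (x + y) = dot m x + dot m y"
  by (simp add: dot_def distrib_left sum.distrib)

lemma dot_diff: "dot m (x - y) = dot m x - dot m y"
  by (simp add: dot_def algebra_simps sum_subtractf)

lemma dot_scaleR: "dot m (c *\<^sub>R x) = c * dot m x"
  by (simp add: dot_def sum_distrib_left mult_ac)

lemma dot_sum: "dot m (\<Sum>i\<in>I. f i) = (\<Sum>i\<in>I. dot m (f i))"
  unfolding dot_def sum_component sum_distrib_left by (rule sum.swap)

lemma dot_0 [simp]: "dot 0 x = 0" "dot m 0 = 0"
  by (simp_all add: dot_def)

lemma dot_add_left: "dot (m + m') x = dot m x + dot m' x"
  by (simp add: dot_def distrib_right sum.distrib)

lemma dot_diff_left: "dot (m - m') x = dot m x - dot m' x"
  by (simp add: dot_def algebra_simps sum_subtractf)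

lemma dot_minus_left: "dot (- m) x = - dot m x"
  by (simp add: dot_def sum_negf)

lemma dot_smult_left: "dot (c *s m) x = of_int c * dot m x"
  by (simp add: dot_def sum_distrib_left mult_ac)

section \<open>Density from small character averages\<close>

lemma one_plus_cos_half:
  "(1 + cos (2 * pi * t)) / 2 = 1 - (norm (ec t - 1))\<^sup>2 / 4"
proof -
  have "(norm (ec t - 1))\<^sup>2 = (cos (2*pi*t) - 1)\<^sup>2 + (sin (2*pi*t))\<^sup>2"
    by (simp add: ec_def cmod_power2)
  also have "\<dots> = 2 - 2 * cos (2*pi*t)"
    using sin_cos_squared_add[of "2*pi*t"] by (simp add: power2_diff)
  finally show ?thesis by (simp add: field_simps)
qed

text \<open>Since \<open>1 + cos 2 \<pi> t = |1 + e(t)|\<^sup>2 / 2\<close>, the power is \<open>(1 + e(t))\<^bsup>2K\<^esup> e(-K t) / 4\<^sup>K\<close>, and the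
binomial theorem applies.\<close>

lemma fejer_power_expansion:
  "of_real (((1 + cos (2 * pi * t)) / 2) ^ K) =
     (\<Sum>a\<le>2*K. of_real (real (2*K choose a) / 4^K) * ec ((real a - real K) * t))"
proof -
  define z where "z = ec t"
  have z: "z * cnj z = 1"
    using complex_norm_square[of z] by (simp add: z_def)
  have "of_real ((1 + cos (2 * pi * t)) / 2) = (1 + z)\<^sup>2 * cnj z / 4"
  proof -
    have "(1 + z)\<^sup>2 * cnj z = cnj z + 2 * (z * cnj z) + z * (z * cnj z)"
      by (simp add: power2_eq_square algebra_simps)
    also have "\<dots> = 2 + (z + cnj z)" using z by simp
    also have "\<dots> = of_real (2 + 2 * cos (2 * pi * t))"
      by (simp add: z_def ec_def complex_eq_iff)
    finally show ?thesis by (simp add: field_simps)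
  qed
  then have "of_real (((1 + cos (2 * pi * t)) / 2) ^ K) = ((1 + z)\<^sup>2 * cnj z / 4) ^ K"
    by (simp only: of_real_power)
  also have "\<dots> = (z + 1) ^ (2 * K) * cnj z ^ K / 4 ^ K"
    by (simp add: power_mult_distrib power_divide power_mult add.commute)
  also have "\<dots> = (\<Sum>a\<le>2*K. of_nat (2*K choose a) * z ^ a) * cnj z ^ K / 4 ^ K"
    by (simp add: binomial_ring)
  also have "\<dots> = (\<Sum>a\<le>2*K. of_real (real (2*K choose a) / 4^K) * (z ^ a * cnj z ^ K))"
    by (simp add: sum_distrib_left sum_distrib_right sum_divide_distrib mult_ac)
  also have "\<dots> = (\<Sum>a\<le>2*K. of_real (real (2*K choose a) / 4^K) * ec ((real a - real K) * t))"
    by (intro sum.cong) (auto simp: left_diff_distrib ec_diff ec_of_nat_mult z_def)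
  finally show ?thesis .
qed

text \<open>The constant term of the concentrated polynomial decays only polynomially in the exponent, by the
lower bound for central binomial coefficients, whereas its values away from the origin decay
exponentially.\<close>

lemma exists_power_below_central_binomial:
  fixes r :: real
  assumes "0 \<le> r" "r < 1" "N > 0"
  shows "\<exists>K::nat. r ^ K < (real (2*K choose K) / 4 ^ K) ^ N / 2"
proof -
  define s where "s = root N r"
  have s: "s ^ N = r" "norm s < 1"
    using assms by (auto simp: s_def real_root_pow_pos2 abs_if)
  have "(\<lambda>K. (2 * (of_nat K * s ^ K)) ^ N) \<longlonglongrightarrow> (2 * 0) ^ N"
    by (intro tendsto_intros powser_times_n_limit_0 s)
  moreover have "(2 * (of_nat K * s ^ K)) ^ N = (2 * real K) ^ N * r ^ K" for K
    by (simp add: power_mult_distrib s(1)[symmetric] power_mult[symmetric] mult_ac)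
  ultimately have lim: "(\<lambda>K. (2 * real K) ^ N * r ^ K) \<longlonglongrightarrow> 0"
    using assms by (simp only: mult_zero_right power_0_left) auto
  have "eventually (\<lambda>K. (2 * real K) ^ N * r ^ K < 1/2) sequentially"
    using order_tendstoD(2)[OF lim, of "1/2"] by simp
  then have "eventually (\<lambda>K. K > 0 \<and> (2 * real K) ^ N * r ^ K < 1/2) sequentially"
    using eventually_gt_at_top[of 0] by eventually_elim simp
  then obtain K where K: "K > 0" "(2 * real K) ^ N * r ^ K < 1/2"
    unfolding eventually_sequentially by blast
  have "1 / (2 * real K) \<le> real (2*K choose K) / 4 ^ K"
    using central_binomial_lower_bound[OF K(1)] K(1) by (simp add: field_simps)
  then have "(1 / (2 * real K)) ^ N \<le> (real (2*K choose K) / 4 ^ K) ^ N"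
    by (intro power_mono) auto
  moreover have "r ^ K < (1 / (2 * real K)) ^ N / 2"
    using K by (simp add: power_divide field_simps)
  ultimately show ?thesis by (intro exI[of _ K]) linarith
qed

text \<open>Let \<open>f\<close> be the product over the coordinates of \<open>((1 + cos 2 \<pi> x\<^sub>i) / 2)\<^sup>K\<close>. If all nonconstant
frequencies of \<open>f\<close> have small averages along the points, the average of \<open>f\<close> over the points
(translated by \<open>q\<close>) is close to the constant term of \<open>f\<close>. If no point were near \<open>q\<close>, that average
would be at most \<open>r\<^sup>K\<close> with \<open>r < 1\<close>, which is smaller. The families are indexed by sets so that
families of the form time times group element are covered.\<close>

lemma trig_poly_concentration:
  fixes eps :: real
  assumes "eps > 0"
  obtains F :: "(int^'n) set" and \<delta> :: real
  where "finite F" "0 \<notin> F" "\<delta> > 0"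
    "\<And>(I :: 'b set) p q. \<lbrakk>finite I; I \<noteq> {};
        \<And>m. m \<in> F \<Longrightarrow> norm (\<Sum>l\<in>I. ec (dot m (p l))) \<le> \<delta> * real (card I)\<rbrakk>
        \<Longrightarrow> \<exists>l\<in>I. \<forall>i. norm (ec (p l $ i) - ec (q $ i)) < eps"
proof -
  \<comment> \<open>If \<open>|e(x\<^sub>i) - 1| \<ge> eps\<close>, then \<open>(1 + cos 2 \<pi> x\<^sub>i) / 2 \<le> r\<close>, by \<open>one_plus_cos_half\<close>.\<close>
  define r where "r = max 0 (1 - eps\<^sup>2 / 4)"
  have "0 \<le> r" "r < 1"
    using assms by (auto simp: r_def)
  then obtain K where K: "r ^ K < (real (2*K choose K) / 4 ^ K) ^ CARD('n) / 2"
    using exists_power_below_central_binomial[of r "CARD('n)"] by auto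
  define A where "A = PiE (UNIV :: 'n set) (\<lambda>_. {..2*K})"
  define a0 where "a0 = (\<lambda>_::'n. K)"
  define coef where "coef a = (\<Prod>i\<in>UNIV. real (2*K choose a i) / 4^K)" for a :: "'n \<Rightarrow> nat"
  \<comment> \<open>The shift by \<open>K\<close> makes the frequencies symmetric; the constant term is at \<open>a = a0\<close>.\<close>
  define freq where "freq a = (\<chi> i. int (a i) - int K)" for a :: "'n \<Rightarrow> nat"
  define f where "f x = (\<Prod>i\<in>UNIV. ((1 + cos (2 * pi * x $ i)) / 2) ^ K)" for x :: "real^'n"
  have finA: "finite A"
    by (auto simp: A_def intro!: finite_PiE)
  have a0: "a0 \<in> A"
    by (auto simp: A_def a0_def)
  have coef_nonneg: "coef a \<ge> 0" for a
    by (auto simp: coef_def intro!: prod_nonneg)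
  have freq0: "freq a = 0 \<longleftrightarrow> a = a0" for a
    by (auto simp: freq_def a0_def vec_eq_iff fun_eq_iff)
  have expand: "of_real (f x) = (\<Sum>a\<in>A. of_real (coef a) * ec (dot (freq a) x))" for x
  proof -
    have "of_real (f x) = (\<Prod>i\<in>UNIV. \<Sum>a\<le>2*K.
        of_real (real (2*K choose a) / 4^K) * ec ((real a - real K) * x $ i))"
      unfolding f_def of_real_prod fejer_power_expansion ..
    also have "\<dots> = (\<Sum>a\<in>A. \<Prod>i\<in>UNIV.
        of_real (real (2*K choose a i) / 4^K) * ec ((real (a i) - real K) * x $ i))"
      unfolding A_def by (rule prod_sum_PiE) auto
    also have "\<dots> = (\<Sum>a\<in>A. of_real (coef a) * ec (dot (freq a) x))"
      unfolding prod.distrib by (simp add: coef_def freq_def dot_def ec_sum)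
    finally show ?thesis .
  qed
  have sum_coef: "(\<Sum>a\<in>A. coef a) = 1"
  proof -
    have "of_real (\<Sum>a\<in>A. coef a) = (of_real (f 0) :: complex)"
      by (simp add: expand)
    also have "f 0 = 1" by (simp add: f_def)
    finally show ?thesis
      using of_real_eq_iff by blast
  qed
  define c0 where "c0 = (real (2*K choose K) / 4 ^ K) ^ CARD('n)"
  have c0: "coef a0 = c0"
    by (simp add: coef_def a0_def c0_def)
  have c0_pos: "c0 > 0"
    by (auto simp: c0_def intro!: divide_pos_pos)
  have small: "f x \<le> r ^ K" if "norm (ec (x $ i) - 1) \<ge> eps" for x :: "real^'n" and i
  proof -
    have half: "0 \<le> (1 + c) / 2" "(1 + c) / 2 \<le> 1" if "- 1 \<le> c" "c \<le> 1" for c :: real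
      using that by auto
    have le: "0 \<le> (1 + cos (2 * pi * x $ j)) / 2" "(1 + cos (2 * pi * x $ j)) / 2 \<le> 1" for j
      by (intro half cos_ge_minus_one cos_le_one)+
    have "eps\<^sup>2 \<le> (norm (ec (x $ i) - 1))\<^sup>2"
      using that assms by (intro power_mono) auto
    then have "(1 + cos (2 * pi * x $ i)) / 2 \<le> r"
      unfolding one_plus_cos_half r_def by auto
    then have "((1 + cos (2 * pi * x $ i)) / 2) ^ K \<le> r ^ K"
      using le by (intro power_mono) auto
    moreover have "(\<Prod>j\<in>UNIV-{i}. ((1 + cos (2 * pi * x $ j)) / 2) ^ K) \<le> 1"
      using le by (intro prod_le_1) (auto intro!: power_le_one zero_le_power)
    moreover have "0 \<le> (\<Prod>j\<in>UNIV-{i}. ((1 + cos (2 * pi * x $ j)) / 2) ^ K)"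
      using le by (intro prod_nonneg) (auto intro!: zero_le_power)
    moreover have "f x = ((1 + cos (2 * pi * x $ i)) / 2) ^ K *
        (\<Prod>j\<in>UNIV-{i}. ((1 + cos (2 * pi * x $ j)) / 2) ^ K)"
      unfolding f_def by (subst prod.remove[of _ i]) auto
    moreover have "r ^ K \<ge> 0" using \<open>0 \<le> r\<close> by simp
    ultimately show ?thesis
      using mult_mono[of "((1 + cos (2 * pi * x $ i)) / 2) ^ K" "r ^ K"
        "\<Prod>j\<in>UNIV-{i}. ((1 + cos (2 * pi * x $ j)) / 2) ^ K" 1] by simp
  qed
  show ?thesis
  proof (rule that[of "freq ` A - {0}" "c0 / 2"])
    fix I :: "'b set" and p q
    assume I: "finite I" "I \<noteq> {}"
      and avg: "\<And>m. m \<in> freq ` A - {0} \<Longrightarrow>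
        norm (\<Sum>l\<in>I. ec (dot m (p l))) \<le> c0 / 2 * real (card I)"
    have card: "real (card I) > 0" using I by (simp add: card_gt_0_iff)
    show "\<exists>l\<in>I. \<forall>i. norm (ec (p l $ i) - ec (q $ i)) < eps"
    proof (rule ccontr)
      assume neg: "\<not> ?thesis"
      have up: "(\<Sum>l\<in>I. f (p l - q)) \<le> real (card I) * r ^ K"
      proof (rule sum_bounded_above)
        fix l assume "l \<in> I"
        with neg obtain i where i: "eps \<le> norm (ec (p l $ i) - ec (q $ i))"
          by (force simp: not_less)
        have "ec (p l $ i) - ec (q $ i) = ec (q $ i) * (ec ((p l - q) $ i) - 1)"
          using ec_add[of "q $ i" "p l $ i - q $ i"] by (simp add: algebra_simps)
        then have "norm (ec (p l $ i) - ec (q $ i)) = norm (ec ((p l - q) $ i) - 1)"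
          by (simp add: norm_mult)
        with i small show "f (p l - q) \<le> r ^ K" by metis
      qed
      define R where "R = (\<Sum>a\<in>A-{a0}. of_real (coef a) * (\<Sum>l\<in>I. ec (dot (freq a) (p l - q))))"
      have "of_real (\<Sum>l\<in>I. f (p l - q)) =
          (\<Sum>a\<in>A. of_real (coef a) * (\<Sum>l\<in>I. ec (dot (freq a) (p l - q))))"
        unfolding of_real_sum expand sum_distrib_left by (rule sum.swap)
      also have "\<dots> = of_real (c0 * real (card I)) + R"
        using freq0[of a0] unfolding R_def by (subst sum.remove[OF finA a0]) (simp add: c0)
      finally have eq: "of_real (\<Sum>l\<in>I. f (p l - q)) - of_real (c0 * real (card I)) = R"
        by simp
      have "norm R \<le> (\<Sum>a\<in>A-{a0}. coef a * (c0 / 2 * real (card I)))"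
        unfolding R_def
      proof (rule sum_norm_le)
        fix a assume a: "a \<in> A - {a0}"
        have "(\<Sum>l\<in>I. ec (dot (freq a) (p l - q))) =
            (\<Sum>l\<in>I. ec (dot (freq a) (p l))) * cnj (ec (dot (freq a) q))"
          by (simp add: dot_diff ec_diff sum_distrib_right)
        then have "norm (\<Sum>l\<in>I. ec (dot (freq a) (p l - q))) \<le> c0 / 2 * real (card I)"
          using avg[of "freq a"] a by (simp add: norm_mult freq0)
        then show "norm (of_real (coef a) * (\<Sum>l\<in>I. ec (dot (freq a) (p l - q))))
            \<le> coef a * (c0 / 2 * real (card I))"
          using mult_left_mono[OF _ coef_nonneg[of a]] coef_nonneg[of a] by (simp only: norm_mult norm_of_real abs_of_nonneg)
      qed
      also have "\<dots> = (\<Sum>a\<in>A-{a0}. coef a) * (c0 / 2 * real (card I))"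
        by (simp add: sum_distrib_right)
      also have "\<dots> \<le> 1 * (c0 / 2 * real (card I))"
      proof (rule mult_right_mono)
        show "(\<Sum>a\<in>A-{a0}. coef a) \<le> 1"
          unfolding sum_coef[symmetric] using finA coef_nonneg by (intro sum_mono2) auto
      qed (use c0_pos in auto)
      finally have "\<bar>(\<Sum>l\<in>I. f (p l - q)) - c0 * real (card I)\<bar> \<le> c0 / 2 * real (card I)"
        unfolding eq[symmetric] of_real_diff[symmetric] norm_of_real by simp
      then have "c0 / 2 * real (card I) \<le> real (card I) * r ^ K"
        using up by linarith
      then have "c0 / 2 \<le> r ^ K" using card by (simp add: mult.commute)
      with K show False by (simp add: c0_def)
    qed
  qed (use finA c0_pos in auto)
qed

lemma geometric_sum_bounded:
  fixes z :: complex
  assumes "norm z = 1" "z \<noteq> 1"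
  shows "norm (\<Sum>a<L. z ^ a) \<le> 2 / norm (1 - z)"
proof -
  have "norm (1 - z ^ L) \<le> 2"
    using norm_triangle_ineq4[of 1 "z ^ L"] assms by (simp add: norm_power)
  then show ?thesis
    using assms by (simp add: sum_gp_strict norm_divide divide_right_mono)
qed

text \<open>The sum over the box \<open>0 \<le> a(m') < L\<close> factors over \<open>m'\<close>; for \<open>m \<in> F\<close> the factor belonging to \<open>m\<close>
itself is a geometric sum with ratio different from 1 and stays bounded, while the others are at
most \<open>L\<close>.\<close>

lemma group_average_small:
  fixes g :: "int^'n \<Rightarrow> real^'n"
  assumes "finite F" "\<delta> > 0" and g: "\<And>m. m \<in> F \<Longrightarrow> dot m (g m) \<notin> \<int>"
  shows "\<exists>I :: (int^'n \<Rightarrow> nat) set. finite I \<and> I \<noteq> {} \<and>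
    (\<forall>m\<in>F. norm (\<Sum>a\<in>I. ec (dot m (\<Sum>m'\<in>F. real (a m') *\<^sub>R g m'))) \<le> \<delta> * real (card I))"
proof -
  have "\<exists>L::nat. L > 0 \<and> (\<forall>m\<in>F. norm (\<Sum>a<L. ec (dot m (g m)) ^ a) \<le> \<delta> * L)"
  proof -
    define C where "C = (\<Sum>m\<in>F. 2 / norm (1 - ec (dot m (g m))))"
    obtain L :: nat where L: "C / \<delta> < L" using reals_Archimedean2 by blast
    have "norm (\<Sum>a<Suc L. ec (dot m (g m)) ^ a) \<le> \<delta> * Suc L" if "m \<in> F" for m
    proof -
      have "norm (\<Sum>a<Suc L. ec (dot m (g m)) ^ a) \<le> 2 / norm (1 - ec (dot m (g m)))"
        using g[OF that] by (intro geometric_sum_bounded) (auto simp: ec_eq_1_iff)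
      also have "\<dots> \<le> C"
        unfolding C_def using assms(1) that by (intro member_le_sum) auto
      also have "\<dots> \<le> \<delta> * Suc L"
        using L assms(2) by (simp add: field_simps)
      finally show ?thesis .
    qed
    then show ?thesis by blast
  qed
  then obtain L :: nat where L: "L > 0"
    "\<And>m. m \<in> F \<Longrightarrow> norm (\<Sum>a<L. ec (dot m (g m)) ^ a) \<le> \<delta> * L" by blast
  define I where "I = PiE F (\<lambda>_. {..<L})"
  have "card I = L ^ card F"
    using assms(1) by (simp add: I_def card_PiE)
  show ?thesis
  proof (intro exI[of _ I] conjI ballI)
    show "finite I" using assms(1) by (auto simp: I_def intro!: finite_PiE)
    show "I \<noteq> {}" using L(1) by (auto simp: I_def PiE_eq_empty_iff)
  next
    fix m assume m: "m \<in> F"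
    have "(\<Sum>a\<in>I. ec (dot m (\<Sum>m'\<in>F. real (a m') *\<^sub>R g m'))) =
        (\<Sum>a\<in>I. \<Prod>m'\<in>F. ec (dot m (g m')) ^ a m')"
      by (simp add: dot_sum dot_scaleR ec_sum ec_of_nat_mult)
    also have "\<dots> = (\<Prod>m'\<in>F. \<Sum>a<L. ec (dot m (g m')) ^ a)"
      unfolding I_def using assms(1) by (intro prod_sum_PiE[symmetric]) auto
    also have "\<dots> = (\<Sum>a<L. ec (dot m (g m)) ^ a) * (\<Prod>m'\<in>F-{m}. \<Sum>a<L. ec (dot m (g m')) ^ a)"
      by (rule prod.remove) (use assms m in auto)
    also have "norm \<dots> \<le> (\<delta> * L) * (\<Prod>m'\<in>F-{m}. real L)"
      unfolding norm_mult
    proof (rule mult_mono)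
      have "norm (\<Sum>a<L. ec (dot m (g m')) ^ a) \<le> real L" for m'
        using norm_sum[of "\<lambda>a. ec (dot m (g m')) ^ a" "{..<L}"] by (simp add: norm_power)
      then show "norm (\<Prod>m'\<in>F-{m}. \<Sum>a<L. ec (dot m (g m')) ^ a) \<le> (\<Prod>m'\<in>F-{m}. real L)"
        unfolding prod_norm[symmetric] by (intro prod_mono) auto
    qed (use L m assms in auto)
    also have "\<dots> = \<delta> * real (card I)"
    proof -
      have "card F = Suc (card (F - {m}))"
        using card.remove[OF assms(1) m] .
      then show ?thesis by (simp add: \<open>card I = _\<close>)
    qed
    finally show "norm (\<Sum>a\<in>I. ec (dot m (\<Sum>m'\<in>F. real (a m') *\<^sub>R g m'))) \<le> \<delta> * real (card I)" .
  qed
qed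

section \<open>Weyl sums\<close>

lemma shifted_sum_bound:
  fixes u :: "nat \<Rightarrow> complex"
  assumes "\<And>j. norm (u j) = 1"
  shows "norm ((\<Sum>j<L. u (j + h)) - (\<Sum>j<L. u j)) \<le> 2 * real h"
proof (induction h)
  case (Suc h)
  have "(\<Sum>j<L. u (j + Suc h)) = (\<Sum>j<L. u (j + h)) + (u (L + h) - u h)"
    using sum.lessThan_Suc_shift[of "\<lambda>j. u (j + h)" L] by (simp add: algebra_simps)
  then have "(\<Sum>j<L. u (j + Suc h)) - (\<Sum>j<L. u j) =
      ((\<Sum>j<L. u (j + h)) - (\<Sum>j<L. u j)) + (u (L + h) - u h)" by simp
  also have "norm \<dots> \<le> 2 * real h + 2"
    by (intro norm_triangle_mono Suc.IH)
       (use norm_triangle_ineq4[of "u (L + h)" "u h"] assms in simp)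
  finally show ?case by simp
qed simp

lemma shifted_average_tendsto_0:
  fixes u :: "nat \<Rightarrow> complex"
  assumes "\<And>j. norm (u j) = 1" "(\<lambda>L. (\<Sum>j<L. u j) / of_nat L) \<longlonglongrightarrow> 0"
  shows "(\<lambda>L. (\<Sum>j<L. u (j + h)) / of_nat L) \<longlonglongrightarrow> 0"
proof -
  have "(\<lambda>L. ((\<Sum>j<L. u (j + h)) - (\<Sum>j<L. u j)) / of_nat L) \<longlonglongrightarrow> 0"
  proof (rule Lim_null_comparison)
    show "eventually (\<lambda>L. norm (((\<Sum>j<L. u (j + h)) - (\<Sum>j<L. u j)) / of_nat L)
        \<le> 2 * real h / real L) sequentially"
      using shifted_sum_bound[of u, OF assms(1)]
      by (intro always_eventually) (auto simp: norm_divide intro!: divide_right_mono)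
    show "(\<lambda>L. 2 * real h / real L) \<longlonglongrightarrow> 0"
      by (rule lim_const_over_n)
  qed
  from tendsto_add[OF this assms(2)] show ?thesis
    by (simp add: diff_divide_distrib)
qed

text \<open>Replacing \<open>u\<^sub>j\<close> by the mean of \<open>u\<^sub>j, \<dots>, u\<^bsub>j+H-1\<^esub>\<close> changes the average by \<open>O(H / L)\<close>. By
the Cauchy-Schwarz inequality the square of the new average is at most the mean of all correlations
with shifts below \<open>H\<close>, of which only the diagonal, contributing \<open>1 / H\<close>, survives in the limit.\<close>

lemma van_der_Corput:
  fixes u :: "nat \<Rightarrow> complex"
  assumes unit: "\<And>j. norm (u j) = 1"
    and corr: "\<And>h. h > 0 \<Longrightarrow> (\<lambda>L. (\<Sum>j<L. u (j + h) * cnj (u j)) / of_nat L) \<longlonglongrightarrow> 0"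
  shows "(\<lambda>L. (\<Sum>j<L. u j) / of_nat L) \<longlonglongrightarrow> 0"
proof (rule LIMSEQ_I)
  fix e :: real assume e: "e > 0"
  \<comment> \<open>The bound for the averages proved below tends to \<open>1 / sqrt H\<close>, which this choice makes less than \<open>e\<close>.\<close>
  obtain H :: nat where H: "(2 / e)\<^sup>2 < real H" using reals_Archimedean2 by blast
  then have Hpos: "H > 0" by (metis gr0I of_nat_0 not_less zero_le_power2)
  define W where "W j = (\<Sum>h<H. u (j + h))" for j
  define Q where "Q L = (\<Sum>j<L. (norm (W j))\<^sup>2) / real L" for L
  have pair: "(\<lambda>L. (\<Sum>j<L. u (j + h) * cnj (u (j + h'))) / of_nat L) \<longlonglongrightarrow> (if h = h' then 1 else 0)"
    for h h'
  proof -
    have lt: "(\<lambda>L. (\<Sum>j<L. u (j + a) * cnj (u (j + b))) / of_nat L) \<longlonglongrightarrow> 0" if "b < a" for a b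
      using shifted_average_tendsto_0[OF _ corr[of "a - b"], of b] that
      by (simp add: norm_mult unit)
    consider "h = h'" | "h' < h" | "h < h'" by linarith
    then show ?thesis
    proof cases
      case 1
      have "eventually (\<lambda>L. (\<Sum>j<L. u (j + h) * cnj (u (j + h'))) / of_nat L = 1) sequentially"
        using eventually_gt_at_top[of 0]
        by eventually_elim (simp add: 1 complex_norm_square[symmetric] unit)
      then show ?thesis by (simp add: 1 tendsto_eventually)
    next
      case 2 then show ?thesis using lt by simp
    next
      case 3
      from tendsto_cnj[OF lt[OF 3]] 3 show ?thesis by (simp add: mult.commute)
    qed
  qed
  have Q_eq: "of_real (Q L) = (\<Sum>h<H. \<Sum>h'<H. (\<Sum>j<L. u (j + h) * cnj (u (j + h'))) / of_nat L)" for L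
  proof -
    have "of_real (\<Sum>j<L. (norm (W j))\<^sup>2) = (\<Sum>j<L. \<Sum>h<H. \<Sum>h'<H. u (j + h) * cnj (u (j + h')))"
      by (simp only: of_real_sum complex_norm_square W_def cnj_sum sum_product)
    also have "\<dots> = (\<Sum>h<H. \<Sum>j<L. \<Sum>h'<H. u (j + h) * cnj (u (j + h')))"
      by (rule sum.swap)
    also have "\<dots> = (\<Sum>h<H. \<Sum>h'<H. \<Sum>j<L. u (j + h) * cnj (u (j + h')))"
      by (intro sum.cong refl sum.swap)
    finally show ?thesis
      unfolding Q_def of_real_divide of_real_of_nat_eq by (simp only: sum_divide_distrib)
  qed
  have "(\<lambda>L. of_real (Q L) :: complex) \<longlonglongrightarrow> (\<Sum>h<H. \<Sum>h'<H. if h = h' then 1 else 0)"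
    unfolding Q_eq by (intro tendsto_sum pair)
  also have "(\<Sum>h<H. \<Sum>h'<H. if h = h' then 1 else 0 :: complex) = of_real (real H)"
    by simp
  finally have Q: "Q \<longlonglongrightarrow> real H"
    by (simp only: tendsto_of_real_iff)
  have bound: "norm ((\<Sum>j<L. u j) / of_nat L) \<le> (sqrt (Q L) + 2 * real H ^ 2 / real L) / real H"
    if L: "L > 0" for L
  proof -
    have "(\<Sum>j<L. W j) = (\<Sum>h<H. \<Sum>j<L. u (j + h))"
      unfolding W_def by (rule sum.swap)
    then have "of_nat H * (\<Sum>j<L. u j) - (\<Sum>j<L. W j) = (\<Sum>h<H. (\<Sum>j<L. u j) - (\<Sum>j<L. u (j + h)))"
      by (simp add: sum_subtractf)
    also have "norm \<dots> \<le> (\<Sum>h<H. 2 * real H)"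
    proof (rule sum_norm_le)
      fix h assume "h \<in> {..<H}"
      then show "norm ((\<Sum>j<L. u j) - (\<Sum>j<L. u (j + h))) \<le> 2 * real H"
        using shifted_sum_bound[of u h L, OF unit] by (simp add: norm_minus_commute)
    qed
    finally have 1: "norm (of_nat H * (\<Sum>j<L. u j) - (\<Sum>j<L. W j)) \<le> 2 * real H ^ 2"
      by (simp add: power2_eq_square)
    have "norm (\<Sum>j<L. W j) \<le> (\<Sum>j<L. norm (W j))" by (rule norm_sum)
    then have "(norm (\<Sum>j<L. W j))\<^sup>2 \<le> (\<Sum>j<L. norm (W j))\<^sup>2"
      by (intro power_mono) auto
    also have "\<dots> \<le> (\<Sum>j<L. (norm (W j))\<^sup>2) * real (card {..<L})"
      by (rule sum_squared_le_sum_of_squares)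
    also have "\<dots> = Q L * real L ^ 2"
      using L by (simp add: Q_def power2_eq_square)
    finally have "norm (\<Sum>j<L. W j) \<le> sqrt (Q L * real L ^ 2)"
      by (rule real_le_rsqrt)
    then have 2: "norm (\<Sum>j<L. W j) \<le> sqrt (Q L) * real L"
      by (simp add: real_sqrt_mult)
    have "real H * norm (\<Sum>j<L. u j) = norm (of_nat H * (\<Sum>j<L. u j))"
      by (simp add: norm_mult)
    also have "\<dots> \<le> sqrt (Q L) * real L + 2 * real H ^ 2"
      using 1 2 norm_triangle_sub[of "of_nat H * (\<Sum>j<L. u j)" "\<Sum>j<L. W j"] by linarith
    finally have *: "real H * norm (\<Sum>j<L. u j) \<le> sqrt (Q L) * real L + 2 * real H ^ 2" .
    have "norm ((\<Sum>j<L. u j) / of_nat L) = real H * norm (\<Sum>j<L. u j) / (real L * real H)"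
      using L Hpos by (simp add: norm_divide)
    also have "\<dots> \<le> (sqrt (Q L) * real L + 2 * real H ^ 2) / (real L * real H)"
      using * by (intro divide_right_mono) auto
    also have "\<dots> = (sqrt (Q L) + 2 * real H ^ 2 / real L) / real H"
      using L Hpos by (simp add: field_simps)
    finally show ?thesis .
  qed
  have "(\<lambda>L. (sqrt (Q L) + 2 * real H ^ 2 / real L) / real H) \<longlonglongrightarrow> (sqrt (real H) + 0) / real H"
    using Hpos by (intro tendsto_intros Q lim_const_over_n) auto
  moreover have "(sqrt (real H) + 0) / real H < e"
  proof -
    have "2 / e < sqrt (real H)" using H by (simp add: real_less_rsqrt)
    then have "1 / sqrt (real H) < e" using e Hpos by (simp add: field_simps)
    moreover have "sqrt (real H) / real H = 1 / sqrt (real H)"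
      using sqrt_divide_self_eq[of "real H"] by (simp only: inverse_eq_divide of_nat_0_le_iff)
    ultimately show ?thesis by (simp only: add_0_right)
  qed
  ultimately have "eventually (\<lambda>L. (sqrt (Q L) + 2 * real H ^ 2 / real L) / real H < e) sequentially"
    by (rule order_tendstoD)
  then have "eventually (\<lambda>L. norm ((\<Sum>j<L. u j) / of_nat L) < e) sequentially"
    using eventually_gt_at_top[of 0] 
  proof eventually_elim
    case (elim L)
    then show ?case using bound[of L] by linarith
  qed
  then show "\<exists>no. \<forall>n\<ge>no. norm ((\<Sum>j<n. u j) / of_nat n - 0) < e"
    by (simp add: eventually_sequentially)
qed

text \<open>For \<open>u\<^sub>j = e(\<theta>\<^sub>j)\<close> this is \<open>e\<close> of the difference \<open>\<theta>\<^bsub>j+h\<^esub> - \<theta>\<^sub>j\<close>; iterating it lowers the degree of a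
polynomial phase.\<close>

definition mdiff :: "nat \<Rightarrow> (nat \<Rightarrow> complex) \<Rightarrow> nat \<Rightarrow> complex" where
  "mdiff h u j = u (j + h) * cnj (u j)"

lemma mdiff_commute: "mdiff h (mdiff h' u) = mdiff h' (mdiff h u)"
  by (auto simp: mdiff_def fun_eq_iff add_ac)

lemma mdiff_iterate_commute: "(mdiff h ^^ r) (mdiff h' u) = mdiff h' ((mdiff h ^^ r) u)"
  by (induction r) (auto simp: mdiff_commute)

lemma norm_mdiff_iterate:
  assumes "\<And>j. norm (u j) = 1"
  shows "norm ((mdiff h ^^ r) u j) = 1"
  using assms by (induction r arbitrary: j) (auto simp: mdiff_def norm_mult)

lemma mdiff_constD:
  assumes "\<And>j. norm (u j) = 1" "mdiff 1 u = (\<lambda>_. w)"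
  shows "u (j + h) = w ^ h * u j"
proof (induction h)
  case (Suc h)
  have "u (Suc (j + h)) * (cnj (u (j + h)) * u (j + h)) = w * u (j + h)"
    using assms(2) by (simp add: mdiff_def fun_eq_iff)
  moreover have "cnj (u (j + h)) * u (j + h) = 1"
    using complex_norm_square[of "u (j + h)"] assms(1) by (simp add: mult.commute)
  ultimately have "u (j + Suc h) = w * u (j + h)" by simp
  then show ?case using Suc.IH by simp
qed simp

text \<open>Van der Corput's inequality reduces the claim for \<open>u\<close> to the claim for its \<open>h\<close>-step differences,
whose iterated differences become constant one step earlier, with value \<open>w\<^sup>h\<close>. Powers of \<open>w\<close> again
are not roots of unity, and the induction ends with a geometric sum.\<close>

lemma Weyl_average_tendsto_0:
  assumes "\<And>j. norm (u j) = 1" "(mdiff 1 ^^ Suc r) u = (\<lambda>_. w)" "\<And>n. n > 0 \<Longrightarrow> w ^ n \<noteq> 1"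
  shows "(\<lambda>L. (\<Sum>j<L. u j) / of_nat L) \<longlonglongrightarrow> 0"
  using assms
proof (induction r arbitrary: u w)
  case 0
  have u: "u j = w ^ j * u 0" for j
    using mdiff_constD[of u w 0 j] 0 by simp
  have w: "norm w = 1"
    using norm_mdiff_iterate[of u 1 1 0] 0 by simp
  have "w \<noteq> 1" using "0.prems"(3)[of 1] by simp
  show ?case
  proof (rule Lim_null_comparison)
    have "(\<Sum>j<L. u j) = (\<Sum>j<L. w ^ j) * u 0" for L
      unfolding sum_distrib_right by (intro sum.cong refl u)
    then have "norm (\<Sum>j<L. u j) \<le> 2 / norm (1 - w)" for L
      using geometric_sum_bounded[OF w \<open>w \<noteq> 1\<close>, of L] 0 by (simp add: norm_mult)
    then show "eventually (\<lambda>L. norm ((\<Sum>j<L. u j) / of_nat L) \<le> 2 / norm (1 - w) / real L) sequentially"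
      unfolding norm_divide norm_of_nat
      by (intro always_eventually allI divide_right_mono) auto
    show "(\<lambda>L. 2 / norm (1 - w) / real L) \<longlonglongrightarrow> 0"
      by (rule lim_const_over_n)
  qed
next
  case (Suc r)
  show ?case
  proof (rule van_der_Corput)
    fix h :: nat assume h: "h > 0"
    define \<phi> where "\<phi> = (mdiff 1 ^^ Suc r) u"
    have unit: "norm (\<phi> j) = 1" for j
      unfolding \<phi>_def by (rule norm_mdiff_iterate) (rule Suc.prems)
    have "mdiff 1 \<phi> = (\<lambda>_. w)"
      using Suc.prems(2) by (simp add: \<phi>_def)
    then have "mdiff h \<phi> = (\<lambda>_. w ^ h)"
      using mdiff_constD[of \<phi> w _ h, OF unit] complex_norm_square[of "\<phi> _"] unit
      by (simp add: mdiff_def fun_eq_iff)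
    then have "(mdiff 1 ^^ Suc r) (mdiff h u) = (\<lambda>_. w ^ h)"
      unfolding mdiff_iterate_commute \<phi>_def .
    moreover have "(w ^ h) ^ n \<noteq> 1" if "n > 0" for n
      using Suc.prems(3)[of "h * n"] h that by (simp add: power_mult)
    ultimately have "(\<lambda>L. (\<Sum>j<L. mdiff h u j) / of_nat L) \<longlonglongrightarrow> 0"
      using Suc.IH[of "mdiff h u" "w ^ h"] Suc.prems(1) norm_mdiff_iterate[of u 1 h] by simp
    then show "(\<lambda>L. (\<Sum>j<L. u (j + h) * cnj (u j)) / of_nat L) \<longlonglongrightarrow> 0"
      by (simp add: mdiff_def)
  qed (rule Suc.prems)
qed


section \<open>Integer matrices and their polynomials\<close>

definition of_int_vec :: "int^'n \<Rightarrow> 'a::ring_1^'n" where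
  "of_int_vec v = (\<chi> i. of_int (v $ i))"

definition of_int_mat :: "int^'n^'m \<Rightarrow> 'a::ring_1^'n^'m" where
  "of_int_mat A = (\<chi> i j. of_int (A $ i $ j))"

lemma of_int_vec_mult: "of_int_vec (A *v v) = of_int_mat A *v of_int_vec v"
  by (simp add: of_int_vec_def of_int_mat_def matrix_vector_mult_def vec_eq_iff)

lemma of_int_vec_eq_0_iff [simp]:
  "(of_int_vec v :: 'a::ring_char_0^'n) = 0 \<longleftrightarrow> v = 0"
  by (simp add: of_int_vec_def vec_eq_iff)

lemma transpose_of_int_mat: "transpose (of_int_mat A) = of_int_mat (transpose A)"
  by (simp add: of_int_mat_def transpose_def vec_eq_iff)

lemma det_ring_hom:
  fixes h :: "'a::comm_ring_1 \<Rightarrow> 'b::comm_ring_1" and M :: "'a^'n^'n"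
  assumes "h 1 = 1" "\<And>a b. h (a + b) = h a + h b" "\<And>a b. h (a * b) = h a * h b"
  shows "det (\<chi> i j. h (M $ i $ j)) = h (det M)"
proof -
  have h0: "h 0 = 0" using assms(2)[of 0 0] by simp
  have h_minus: "h (- a) = - h a" for a
    using assms(2)[of a "- a"] h0 by (simp add: eq_neg_iff_add_eq_0 add.commute)
  have h_sum: "h (\<Sum>x\<in>S. f x) = (\<Sum>x\<in>S. h (f x))" for S :: "('n \<Rightarrow> 'n) set" and f
    by (induction S rule: infinite_finite_induct) (auto simp: h0 assms)
  have h_prod: "h (\<Prod>x\<in>S. f x) = (\<Prod>x\<in>S. h (f x))" for S :: "'n set" and f
    by (induction S rule: infinite_finite_induct) (auto simp: assms)
  have h_sign: "h (of_int (sign p)) = of_int (sign p)" for p :: "'n \<Rightarrow> 'n"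
    by (simp add: sign_def assms h_minus)
  show ?thesis
    by (simp add: det_def h_sum h_prod h_sign assms(3))
qed

lemma det_of_int_mat: "det (of_int_mat A :: 'a::comm_ring_1^'n^'n) = of_int (det A)"
  unfolding of_int_mat_def by (rule det_ring_hom) auto

lemma field_kernel_iff_det_0:
  fixes A :: "'a::field^'n^'n"
  shows "(\<exists>x. x \<noteq> 0 \<and> A *v x = 0) \<longleftrightarrow> det A = 0"
  using invertible_det_nz[of A] invertible_left_inverse[of A] matrix_left_invertible_ker[of A] by blast

text \<open>A rational kernel vector exists over the field of fractions; clearing its denominators makes it
integral.\<close>

lemma integer_kernel_if_det_0:
  fixes P :: "int^'n^'n"
  assumes "det P = 0"
  obtains m where "m \<noteq> 0" "P *v m = 0"
proof -
  have "det (of_int_mat P :: rat^'n^'n) = 0"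
    using assms by (simp add: det_of_int_mat)
  then obtain x :: "rat^'n" where x: "x \<noteq> 0" "of_int_mat P *v x = 0"
    using field_kernel_iff_det_0 by blast
  define d where "d = (\<Prod>i\<in>UNIV. snd (quotient_of (x $ i)))"
  have d: "d \<noteq> 0"
    using quotient_of_denom_pos' by (auto simp: d_def) (metis less_irrefl)
  have "\<exists>z::int. of_int d * x $ i = of_int z" for i
  proof -
    have "x $ i = of_int (fst (quotient_of (x $ i))) / of_int (snd (quotient_of (x $ i)))"
      by (simp add: quotient_of_div)
    moreover have "of_int (snd (quotient_of (x $ i))) \<noteq> (0::rat)"
      using quotient_of_denom_pos'[of "x $ i"] by simp
    ultimately have "of_int (snd (quotient_of (x $ i))) * x $ i = of_int (fst (quotient_of (x $ i)))"
      by (metis nonzero_mult_div_cancel_left times_divide_eq_right)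
    moreover have "d = (\<Prod>j\<in>UNIV-{i}. snd (quotient_of (x $ j))) * snd (quotient_of (x $ i))"
      unfolding d_def by (subst prod.remove[of _ i]) (auto simp: mult.commute)
    ultimately show ?thesis
      by (intro exI[of _ "(\<Prod>j\<in>UNIV-{i}. snd (quotient_of (x $ j))) * fst (quotient_of (x $ i))"])
         (simp add: mult.assoc)
  qed
  then obtain z where z: "\<And>i. of_int d * x $ i = of_int (z i)" by metis
  define m where "m = (\<chi> i. z i)"
  have m: "of_int_vec m = of_int d *s x"
    by (simp add: of_int_vec_def m_def vec_eq_iff z)
  have "of_int_vec (P *v m) = (0 :: rat^'n)"
    unfolding of_int_vec_mult m vector_scalar_commute x by simp
  moreover have "(of_int_vec m :: rat^'n) \<noteq> 0"
    unfolding m using x d by (auto simp: vec_eq_iff)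
  ultimately show ?thesis
    using that by simp
qed

lemma integer_kernel_if_complex_kernel:
  fixes P :: "int^'n^'n" and v :: "complex^'n"
  assumes "v \<noteq> 0" "of_int_mat P *v v = 0"
  obtains m where "m \<noteq> 0" "P *v m = 0"
proof -
  have "det (of_int_mat P :: complex^'n^'n) = 0"
    using assms field_kernel_iff_det_0 by blast
  then have "det P = 0" by (simp add: det_of_int_mat)
  then show ?thesis using integer_kernel_if_det_0 that by blast
qed

definition pmat :: "'a::comm_ring_1 poly \<Rightarrow> 'a^'n^'n \<Rightarrow> 'a^'n^'n" where
  "pmat p B = fold_coeffs (\<lambda>a M. mat a + B ** M) p 0"

lemma mat_mult_vec: "mat a *v x = a *s (x :: 'a::comm_ring_1^'n)"
  by (simp add: matrix_vector_mult_def mat_def vec_eq_iff if_distrib[of "\<lambda>z. z * _"] cong: if_cong)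

lemma scalar_commute: "A *v (c *s x) = c *s (A *v (x :: 'a::comm_ring_1^'n))"
  by (simp add: vector_scalar_mult_def matrix_vector_mult_def mult_ac sum_distrib_left)

lemma pmat_0 [simp]: "pmat 0 B = 0"
  by (simp add: pmat_def)

lemma pmat_pCons: "pmat (pCons a p) B = mat a + B ** pmat p B"
proof (cases "a = 0 \<and> p = 0")
  case True
  then show ?thesis by (simp add: pmat_def mat_def vec_eq_iff matrix_matrix_mult_def)
next
  case False
  then show ?thesis
    by (cases "a = 0") (auto simp: pmat_def)
qed

lemma pmat_vec_pCons: "pmat (pCons a p) B *v x = a *s x + B *v (pmat p B *v x)"
  by (simp add: pmat_pCons matrix_vector_mult_add_rdistrib mat_mult_vec matrix_vector_mul_assoc)

lemma pmat_vec_add: "pmat (p + q) B *v x = pmat p B *v x + pmat q B *v x"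
  by (induction p q rule: poly_induct2)
     (auto simp: pmat_vec_pCons matrix_vector_right_distrib vector_sadd_rdistrib add_ac)

lemma pmat_vec_smult: "pmat (smult c p) B *v x = c *s (pmat p B *v x)"
  by (induction p) (auto simp: pmat_vec_pCons vector_add_ldistrib scalar_commute vector_smult_assoc)

lemma pmat_vec_commute: "pmat p B *v (B *v x) = B *v (pmat p B *v x)"
  by (induction p) (auto simp: pmat_vec_pCons matrix_vector_right_distrib scalar_commute)

lemma pmat_vec_mult: "pmat (p * q) B *v x = pmat p B *v (pmat q B *v x)"
  by (induction p) (auto simp: pmat_vec_pCons pmat_vec_add pmat_vec_smult)

lemma pmat_vec_mult': "pmat p B *v (pmat q B *v x) = pmat q B *v (pmat p B *v x)"
  by (simp add: pmat_vec_mult[symmetric] mult.commute)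

lemma pmat_vec_1 [simp]: "pmat 1 B *v x = x"
  by (simp add: one_pCons pmat_vec_pCons)

lemma pmat_vec_power: "pmat (p ^ r) B *v x = (((\<lambda>x. pmat p B *v x) ^^ r) x)"
  by (induction r) (auto simp: pmat_vec_mult)

lemma of_int_mat_pmat:
  "of_int_mat (pmat p B) = pmat (map_poly of_int p) (of_int_mat B :: 'a::comm_ring_1^'n^'n)"
proof (induction p)
  case (pCons a p)
  have "of_int_mat (mat a + B ** M) = mat (of_int a) + of_int_mat B ** (of_int_mat M :: 'a^'n^'n)" for M
    by (auto simp: of_int_mat_def mat_def matrix_matrix_mult_def vec_eq_iff)
  with pCons show ?case by (simp add: pmat_pCons map_poly_pCons)
qed (simp add: of_int_mat_def vec_eq_iff)

lemma pmat_eigenvector: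
  assumes "B *v w = b *s w"
  shows "pmat p B *v w = poly p b *s w"
  by (induction p) (auto simp: pmat_vec_pCons scalar_commute assms vector_smult_assoc vector_sadd_rdistrib mult.commute)

definition ipoly :: "int poly \<Rightarrow> 'a::comm_ring_1 \<Rightarrow> 'a" where
  "ipoly p x = poly (map_poly of_int p) x"

lemma ipoly_0 [simp]: "ipoly 0 x = 0"
  and ipoly_pCons: "ipoly (pCons a p) x = of_int a + x * ipoly p x"
  by (simp_all add: ipoly_def map_poly_pCons)

lemma ipoly_add: "ipoly (p + q) x = ipoly p x + ipoly q x"
  by (induction p q rule: poly_induct2) (auto simp: ipoly_pCons algebra_simps)

lemma ipoly_smult: "ipoly (smult c p) x = of_int c * ipoly p x"
  by (induction p) (auto simp: ipoly_pCons algebra_simps)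

lemma ipoly_mult: "ipoly (p * q) x = ipoly p x * ipoly q x"
  by (induction p) (auto simp: ipoly_pCons ipoly_add ipoly_smult algebra_simps)

lemma ipoly_1 [simp]: "ipoly 1 x = 1"
  by (simp add: one_pCons ipoly_pCons)

lemma ipoly_power: "ipoly (p ^ n) x = ipoly p x ^ n"
  by (induction n) (auto simp: ipoly_mult)

lemma ipoly_of_int: "ipoly p (of_int x) = of_int (poly p x)"
  by (induction p) (auto simp: ipoly_pCons)

lemma ipoly_dvd: "p dvd q \<Longrightarrow> ipoly p x = 0 \<Longrightarrow> ipoly q x = 0"
  by (auto simp: dvd_def ipoly_mult)

lemma ipoly_charpoly:
  fixes x :: "'a::comm_ring_1"
  shows "ipoly (charpoly A) x = det (mat x - of_int_mat A)"
proof -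
  have "det (\<chi> i j. ipoly ((mat [:0, 1:] - (\<chi> i j. [:A $ i $ j:])) $ i $ j) x) = ipoly (charpoly A) x"
    unfolding charpoly_def by (rule det_ring_hom) (auto simp: ipoly_add ipoly_mult)
  moreover have "(\<chi> i j. ipoly ((mat [:0, 1:] - (\<chi> i j. [:A $ i $ j:])) $ i $ j) x) = mat x - of_int_mat A"
    by (auto simp: vec_eq_iff mat_def of_int_mat_def ipoly_pCons)
  ultimately show ?thesis by simp
qed

lemma charpoly_root_iff:
  fixes x :: "'a::field"
  shows "ipoly (charpoly A) x = 0 \<longleftrightarrow> (\<exists>w. w \<noteq> 0 \<and> of_int_mat (transpose A) *v w = x *s w)"
proof -
  have "ipoly (charpoly A) x = det (transpose (mat x - of_int_mat A))"
    by (simp add: ipoly_charpoly det_transpose)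
  also have "transpose (mat x - of_int_mat A) = mat x - of_int_mat (transpose A)"
    by (auto simp: transpose_def mat_def of_int_mat_def vec_eq_iff)
  finally show ?thesis
    by (auto simp: field_kernel_iff_det_0[symmetric] matrix_vector_mult_diff_rdistrib mat_mult_vec)
qed

text \<open>In the Leibniz expansion only the identity permutation uses all diagonal entries; every other term
misses at least one and has degree below \<open>n\<close>.\<close>

lemma lead_coeff_charpoly: "lead_coeff (charpoly A) = 1"
proof -
  let ?M = "mat [:0, 1:] - (\<chi> i j. [:A $ i $ j:]) :: int poly^'a^'a"
  let ?n = "CARD('a)"
  let ?t = "\<lambda>p. of_int (sign p) * (\<Prod>i\<in>UNIV. ?M $ i $ p i)"
  let ?P = "{p. p permutes (UNIV :: 'a set)}"
  have M: "?M $ i $ j = (if i = j then [:- A $ i $ i, 1:] else [:- A $ i $ j:])" for i j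
    by (simp add: mat_def)
  have degM: "degree (?M $ i $ j) \<le> (if i = j then 1 else 0)" for i j
    unfolding M by auto
  have id: "degree (?t id) = ?n \<and> lead_coeff (?t id) = 1"
  proof
    have "(\<Prod>i\<in>UNIV. ?M $ i $ i) = (\<Prod>i\<in>UNIV. [:- A $ i $ i, 1:])" unfolding M by simp
    moreover have "degree (\<Prod>i\<in>(UNIV :: 'a set). [:- A $ i $ i, 1:]) = ?n"
      by (subst degree_prod_eq_sum_degree) auto
    moreover have "lead_coeff (\<Prod>i\<in>(UNIV :: 'a set). [:- A $ i $ i, 1:]) = 1"
      by (subst lead_coeff_prod) auto
    ultimately show "degree (?t id) = ?n" "lead_coeff (?t id) = 1" by simp_all
  qed
  have other: "degree (?t p) < ?n" if p: "p \<noteq> id" for p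
  proof -
    obtain i0 where i0: "p i0 \<noteq> i0" using p by (auto simp: fun_eq_iff)
    have "degree (?t p) \<le> degree (\<Prod>i\<in>UNIV. ?M $ i $ p i)"
      by (simp add: sign_def)
    also have "\<dots> \<le> (\<Sum>i\<in>UNIV. degree (?M $ i $ p i))"
      using degree_prod_sum_le[of UNIV "\<lambda>i. ?M $ i $ p i"] by (simp only: o_def finite)
    also have "\<dots> \<le> (\<Sum>i\<in>UNIV. if i = i0 then 0 else 1)"
    proof (rule sum_mono)
      fix i show "degree (?M $ i $ p i) \<le> (if i = i0 then 0 else 1)"
        using degM[of i "p i"] i0 by (cases "i = p i") auto
    qed
    also have "\<dots> = card (UNIV - {i0})"
      by (simp add: sum.If_cases Collect_neg_eq Compl_eq_Diff_UNIV)
    also have "\<dots> < ?n"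
      by (simp add: card_Diff_singleton)
    finally show ?thesis .
  qed
  have "charpoly A = ?t id + (\<Sum>p\<in>?P - {id}. ?t p)"
    unfolding charpoly_def det_def
    by (rule sum.remove) (auto simp: finite_permutations permutes_id)
  moreover have "degree (\<Sum>p\<in>?P - {id}. ?t p) < degree (?t id)"
    unfolding conjunct1[OF id] by (rule degree_sum_less) (use other in auto)
  ultimately have "lead_coeff (charpoly A) = lead_coeff (?t id)"
    using lead_coeff_add_le[of "\<Sum>p\<in>?P - {id}. ?t p" "?t id"] by (simp only: add.commute)
  then show ?thesis unfolding conjunct2[OF id] .
qed

section \<open>Unimodular factors of the characteristic polynomial\<close>

text \<open>Split off one linear factor of \<open>s\<close> after the other: the last nonzero vector before reaching 0 is an
eigenvector.\<close>

lemma complex_eigenvector_from_annihilator: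
  fixes B :: "complex^'n^'n"
  assumes "s \<noteq> 0" "v \<noteq> 0" "pmat s B *v v = 0"
  obtains b w where "poly s b = 0" "w \<noteq> 0" "B *v w = b *s w"
proof -
  have "\<exists>b w. poly s b = 0 \<and> w \<noteq> 0 \<and> B *v w = b *s w"
    using assms
  proof (induction "degree s" arbitrary: s rule: less_induct)
    case less
    have "degree s \<noteq> 0"
    proof
      assume "degree s = 0"
      then obtain c where "s = [:c:]" by (rule degree_eq_zeroE)
      with less.prems show False by (auto simp: pmat_vec_pCons vec_eq_iff)
    qed
    then have "\<not> constant (poly s)" by (simp add: constant_degree)
    then obtain b where b: "poly s b = 0"
      using fundamental_theorem_of_algebra by blast
    then obtain t where t: "s = [:- b, 1:] * t" by (auto simp: poly_eq_0_iff_dvd)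
    then have "t \<noteq> 0" using less.prems by auto
    have "degree t < degree s"
      unfolding t using \<open>t \<noteq> 0\<close> by (subst degree_mult_eq) auto
    show ?case
    proof (cases "pmat t B *v v = 0")
      case True
      then obtain b' w where "poly t b' = 0" "w \<noteq> 0" "B *v w = b' *s w"
        using less.hyps[OF \<open>degree t < degree s\<close> \<open>t \<noteq> 0\<close>] less.prems(2) by blast
      then show ?thesis unfolding t by (intro exI[of _ b'] exI[of _ w]) simp
    next
      case False
      have "pmat [:- b, 1:] B *v (pmat t B *v v) = 0"
        using less.prems(3) by (simp add: t pmat_vec_mult del: mult_pCons_left)
      then have "B *v (pmat t B *v v) = b *s (pmat t B *v v)"
        by (simp add: pmat_vec_pCons vector_sneg_minus1[symmetric])
      with b False show ?thesis by blast
    qed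
  qed
  then show ?thesis using that by blast
qed

text \<open>The primitive part of an annihilating polynomial of least degree works: pseudo-division shows that
it divides a nonzero integer multiple of \<open>h\<close>, and Gauss' lemma removes the multiple.\<close>

lemma integer_minimal_polynomial:
  fixes x :: "'a::{idom,ring_char_0}"
  assumes "f \<noteq> 0" "ipoly f x = 0"
  obtains q where "degree q > 0" "ipoly q x = 0" "\<And>h. ipoly h x = 0 \<Longrightarrow> q dvd h"
proof -
  obtain q0 where q0: "q0 \<noteq> 0" "ipoly q0 x = 0"
    and least: "\<And>h. h \<noteq> 0 \<Longrightarrow> ipoly h x = 0 \<Longrightarrow> degree q0 \<le> degree h"
    using ex_has_least_nat[of "\<lambda>h. h \<noteq> 0 \<and> ipoly h x = 0" f degree] assms by blast
  define q where "q = primitive_part q0"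
  have q0_eq: "q0 = smult (content q0) q" by (simp add: q_def)
  have deg: "degree q = degree q0" by (simp add: q_def)
  have "q \<noteq> 0" using q0 by (simp add: q_def)
  have "of_int (content q0) * ipoly q x = 0"
    using q0(2) by (metis q0_eq ipoly_smult)
  then have root: "ipoly q x = 0" using q0(1) by simp
  show ?thesis
  proof (rule that)
    show "ipoly q x = 0" by fact
    show "degree q > 0"
    proof (rule ccontr)
      assume "\<not> ?thesis"
      then obtain c where "q = [:c:]" using degree_eq_zeroE by blast
      with root \<open>q \<noteq> 0\<close> show False by (simp add: ipoly_pCons)
    qed
  next
    fix h assume h: "ipoly h x = 0"
    define r where "r = pseudo_mod h q"
    obtain a u where a: "a \<noteq> 0" "smult a h = q * u + r"
      using pseudo_mod(1)[OF \<open>q \<noteq> 0\<close>, of h] by (auto simp: r_def)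
    have "ipoly (smult a h) x = 0" using h by (simp add: ipoly_smult)
    then have "ipoly r x = 0" using root by (simp add: a ipoly_add ipoly_mult)
    then have "r = 0"
      using pseudo_mod(2)[OF \<open>q \<noteq> 0\<close>, of h] least[of r] deg unfolding r_def by linarith
    then have "q dvd smult a h" using a by simp
    then have "primitive_part q dvd primitive_part (smult a h)" by blast
    moreover have "primitive_part q = q" by (simp add: q_def primitive_part_prim q0)
    moreover have "smult (unit_factor a) (primitive_part h) dvd h"
    proof -
      have "h = smult (content h * unit_factor a) (smult (unit_factor a) (primitive_part h))"
        using a(1) by (simp add: mult.assoc)
      then show ?thesis by (metis dvd_refl dvd_smult)
    qed
    ultimately show "q dvd h"
      by (metis primitive_part_smult dvd_trans)
  qed
qed

text \<open>The polynomials \<open>s\<close> and \<open>f\<^sub>A\<close> have a common complex root \<open>b\<close>, and \<open>b \<noteq> 1\<close> because \<open>s(1) \<noteq> 0\<close>; so \<open>b\<close>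
is a root of \<open>g\<close>. Its primitive minimal polynomial divides \<open>g\<close>, whose leading coefficient is a unit, and
\<open>s\<close>, whose constant coefficient is a unit.\<close>

lemma unimodular_factor_from_annihilator:
  fixes A :: "int^'n^'n"
  assumes "charpoly A = [:1, -1:] ^ k * g"
    and "m \<noteq> 0" "pmat s (transpose A) *v m = 0"
    and s: "coeff s 0 \<in> {-1, 1}" "poly s 1 \<noteq> 0"
  obtains p where "unimodular_poly p" "p dvd g"
proof -
  let ?s = "map_poly of_int s :: complex poly"
  have "s \<noteq> 0" using s by auto
  then have "?s \<noteq> 0" by (simp add: map_poly_eq_0_iff)
  have "pmat ?s (of_int_mat (transpose A)) *v of_int_vec m = 0"
    using assms(3) by (simp flip: of_int_mat_pmat of_int_vec_mult)
  then obtain b w where b: "poly ?s b = 0" and w: "w \<noteq> 0" "of_int_mat (transpose A) *v w = b *s w"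
    using complex_eigenvector_from_annihilator[OF \<open>?s \<noteq> 0\<close>, of "of_int_vec m"] assms(2) by auto
  have sb: "ipoly s b = 0" using b by (simp add: ipoly_def)
  have "b \<noteq> 1"
    using sb s(2) ipoly_of_int[of s 1, where 'a = complex] by auto
  have "ipoly (charpoly A) b = 0" using w charpoly_root_iff by blast
  then have gb: "ipoly g b = 0"
    using \<open>b \<noteq> 1\<close> by (simp add: assms(1) ipoly_mult ipoly_power ipoly_pCons)
  obtain q where q: "degree q > 0" "\<And>h. ipoly h b = 0 \<Longrightarrow> q dvd h"
    using integer_minimal_polynomial[OF \<open>s \<noteq> 0\<close> sb] by metis
  obtain c where c: "g = q * c" using q(2)[OF gb] by auto
  have "1 = lead_coeff ([:1, -1:] ^ k :: int poly) * (lead_coeff q * lead_coeff c)"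
    using lead_coeff_charpoly[of A] by (simp add: assms(1) c lead_coeff_mult)
  then have "lead_coeff q dvd 1"
    by (metis dvd_mult dvd_triv_left)
  then have lead: "lead_coeff q \<in> {-1, 1}"
    by (auto simp: abs_if split: if_splits)
  obtain c' where "s = q * c'" using q(2)[OF sb] by auto
  then have "coeff s 0 = coeff q 0 * coeff c' 0" by (simp add: coeff_mult)
  then have "coeff q 0 dvd coeff s 0" by simp
  moreover have "coeff s 0 dvd 1" using s(1) by auto
  ultimately have "coeff q 0 dvd 1" by (rule dvd_trans)
  then have const: "coeff q 0 \<in> {-1, 1}"
    by (auto simp: abs_if split: if_splits)
  show ?thesis
  proof (rule that[of "smult (lead_coeff q) q"])
    show "unimodular_poly (smult (lead_coeff q) q)"
      using lead const q(1) by (auto simp: unimodular_poly_def)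
    show "smult (lead_coeff q) q dvd g"
      using lead by (auto simp: c)
  qed
qed

text \<open>A complex root of \<open>p\<close> is an eigenvalue, so \<open>p\<close> of the transposed matrix is singular over the complex
numbers, hence over the integers.\<close>

lemma integer_eigen_kernel:
  fixes A :: "int^'n^'n"
  assumes "degree p > 0" "p dvd charpoly A"
  obtains m where "m \<noteq> 0" "pmat p (transpose A) *v m = 0"
proof -
  let ?p = "map_poly of_int p :: complex poly"
  have "degree ?p = degree p" by (rule degree_map_poly) simp
  then have "\<not> constant (poly ?p)" using assms(1) by (simp add: constant_degree)
  then obtain b where b: "poly ?p b = 0" using fundamental_theorem_of_algebra by blast
  then have "ipoly (charpoly A) b = 0"
    using ipoly_dvd[OF assms(2), of b] by (simp add: ipoly_def)
  then obtain w where w: "w \<noteq> 0" "of_int_mat (transpose A) *v w = b *s w"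
    using charpoly_root_iff by blast
  have "of_int_mat (pmat p (transpose A)) *v w = 0"
    unfolding of_int_mat_pmat pmat_eigenvector[OF w(2)] b by simp
  then show ?thesis
    using integer_kernel_if_complex_kernel w(1) that by blast
qed

section \<open>Characters that remain integral under the inverse\<close>

interpretation zvec: module "(*s) :: int \<Rightarrow> int^'n \<Rightarrow> int^'n"
  by unfold_locales (auto simp: vector_add_ldistrib vector_sadd_rdistrib vector_smult_assoc)

text \<open>This is the Noetherian property of the integer lattice, by induction on a finite set of coordinates
that supports the vectors. To remove the coordinate \<open>a\<close>, choose \<open>x\<close> in the union of the spans with the
least positive value \<open>d\<close> there; \<open>d\<close> divides the \<open>a\<close>-th coordinate of every vector, and subtracting
multiples of \<open>x\<close> makes that coordinate vanish.\<close>

lemma integer_sequence_span_stabilizes: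
  fixes w :: "nat \<Rightarrow> int^'n"
  shows "\<exists>J. w J \<in> zvec.span (w ` {..<J})"
proof -
  have "\<exists>J. w J \<in> zvec.span (w ` {..<J})"
    if "finite I" "\<And>j i. i \<notin> I \<Longrightarrow> w j $ i = 0" for I and w :: "nat \<Rightarrow> int^'n"
    using that
  proof (induction I arbitrary: w rule: finite_induct)
    case empty
    then have "w 0 = 0" by (simp add: vec_eq_iff)
    then show ?case using zvec.span_zero by metis
  next
    case (insert a I)
    show ?case
    proof (cases "\<forall>j. w j $ a = 0")
      case True
      then show ?thesis using insert.prems by (intro insert.IH) (metis insert_iff)
    next
      case False
      define U where "U = (\<Union>J. zvec.span (w ` {..<J}))"
      define P where "P d \<longleftrightarrow> d > 0 \<and> (\<exists>x\<in>U. x $ a = int d)" for d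
      have U_w: "w j \<in> U" for j
        unfolding U_def by (rule UN_I[of "Suc j"]) (auto intro: zvec.span_base)
      have U_comb: "x - c *s y \<in> U" if xy: "x \<in> U" "y \<in> U" for x y c
      proof -
        obtain J J' where "x \<in> zvec.span (w ` {..<J})" "y \<in> zvec.span (w ` {..<J'})"
          using xy by (auto simp: U_def)
        moreover have "zvec.span (w ` {..<J}) \<subseteq> zvec.span (w ` {..<max J J'})"
          "zvec.span (w ` {..<J'}) \<subseteq> zvec.span (w ` {..<max J J'})"
          by (intro zvec.span_mono; force)+
        ultimately show ?thesis
          by (auto simp: U_def intro!: exI[of _ "max J J'"] zvec.span_diff zvec.span_scale)
      qed
      obtain j0 where j0: "w j0 $ a \<noteq> 0" using False by blast
      have U_neg: "- w j0 \<in> U"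
        using U_comb[OF U_comb[OF U_w[of j0] U_w[of j0], of 1] U_w[of j0], of 1] by simp
      have "P (nat \<bar>w j0 $ a\<bar>)"
        unfolding P_def using j0 U_w[of j0] U_neg
        by (cases "w j0 $ a > 0") (auto intro: bexI[of _ "w j0"] bexI[of _ "- w j0"])
      define d where "d = (LEAST d. P d)"
      have "P d" unfolding d_def by (rule LeastI) fact
      then obtain x where x: "d > 0" "x \<in> U" "x $ a = int d" by (auto simp: P_def)
      then obtain J0 where J0: "x \<in> zvec.span (w ` {..<J0})" by (auto simp: U_def)
      have dvd: "w j $ a mod int d = 0" for j
      proof (rule ccontr)
        assume ne: "w j $ a mod int d \<noteq> 0"
        have "w j - (w j $ a div int d) *s x \<in> U" by (intro U_comb U_w x)
        moreover have "(w j - (w j $ a div int d) *s x) $ a = w j $ a mod int d"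
          by (simp add: x minus_div_mult_eq_mod)
        moreover have "0 < w j $ a mod int d" "w j $ a mod int d < int d"
          using ne x(1) pos_mod_sign[of "int d" "w j $ a"] pos_mod_bound[of "int d" "w j $ a"]
          by linarith+
        ultimately have "P (nat (w j $ a mod int d))" "nat (w j $ a mod int d) < d"
          unfolding P_def by (auto intro!: bexI[of _ "w j - (w j $ a div int d) *s x"])
        then show False unfolding d_def using not_less_Least by blast
      qed
      define w' where "w' j = w (J0 + j) - (w (J0 + j) $ a div int d) *s x" for j
      have x0: "x $ i = 0" if "i \<notin> insert a I" for i
        using J0
      proof (induction rule: zvec.span_induct_alt)
        case (step c y z)
        then show ?case using insert.prems[OF that] by auto
      qed simp
      have "\<exists>J. w' J \<in> zvec.span (w' ` {..<J})"
      proof (rule insert.IH)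
        fix j i assume "i \<notin> I"
        show "w' j $ i = 0"
        proof (cases "i = a")
          case True
          then show ?thesis
            using dvd[of "J0 + j"] by (simp add: w'_def x minus_div_mult_eq_mod)
        next
          case False
          then show ?thesis
            using \<open>i \<notin> I\<close> x0[of i] insert.prems[of i] by (simp add: w'_def)
        qed
      qed
      then obtain J where J: "w' J \<in> zvec.span (w' ` {..<J})" by blast
      let ?S = "zvec.span (w ` {..<J0 + J})"
      have xS: "x \<in> ?S"
        using J0 zvec.span_mono[of "w ` {..<J0}" "w ` {..<J0 + J}"] by (force simp: image_mono)
      have "w' j \<in> ?S" if "j < J" for j
      proof -
        have "w (J0 + j) \<in> ?S" using that by (intro zvec.span_base) auto
        then show ?thesis unfolding w'_def by (intro zvec.span_diff zvec.span_scale xS)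
      qed
      then have "w' ` {..<J} \<subseteq> ?S" by blast
      then have "w' J \<in> ?S"
        using J zvec.span_minimal[OF _ zvec.subspace_span] by blast
      then have "w' J + (w (J0 + J) $ a div int d) *s x \<in> ?S"
        by (intro zvec.span_add zvec.span_scale xS)
      then show ?thesis unfolding w'_def by auto
    qed
  qed
  from this[of UNIV w] show ?thesis by simp
qed

text \<open>Since \<open>B\<^sup>J w\<^sub>i = B\<^bsup>J-i\<^esup> w\<^sub>0\<close> for \<open>i \<le> J\<close>, applying \<open>B\<^sup>J\<close> to a relation that expresses \<open>w\<^sub>J\<close> by
\<open>w\<^sub>0, \<dots>, w\<^bsub>J-1\<^esub>\<close> expresses \<open>w\<^sub>0\<close> by a polynomial in \<open>B\<close> without constant term.\<close>

lemma divisible_orbit_annihilator: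
  fixes B :: "int^'n^'n" and w :: "nat \<Rightarrow> int^'n"
  assumes "\<And>j. w j = B *v w (Suc j)"
  obtains s where "coeff s 0 = 1" "pmat s B *v w 0 = 0"
proof -
  obtain J where J: "w J \<in> zvec.span (w ` {..<J})"
    using integer_sequence_span_stabilizes by blast
  have X: "pmat [:0, 1:] B *v x = B *v x" for x
    by (simp add: pmat_vec_pCons)
  have shift: "pmat ([:0, 1:] ^ j) B *v w (i + j) = w i" for i j
  proof (induction j)
    case (Suc j)
    have "pmat ([:0, 1:] ^ Suc j) B *v w (i + Suc j)
        = pmat ([:0, 1:] ^ j) B *v (pmat [:0, 1:] B *v w (Suc (i + j)))"
      by (simp only: power_Suc2 pmat_vec_mult add_Suc_right)
    also have "\<dots> = w i" unfolding X assms[symmetric] by (rule Suc)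
    finally show ?case .
  qed simp
  have "\<exists>t. coeff t 0 = 0 \<and> pmat ([:0, 1:] ^ J) B *v x = pmat t B *v w 0"
    if "x \<in> zvec.span (w ` {..<J})" for x
    using that
  proof (induction rule: zvec.span_induct_alt)
    case base
    show ?case by (rule exI[of _ 0]) simp
  next
    case (step c x y)
    then obtain i where i: "i < J" "x = w i" by blast
    from step obtain t where t: "coeff t 0 = 0" "pmat ([:0, 1:] ^ J) B *v y = pmat t B *v w 0" by blast
    have "pmat ([:0, 1:] ^ J) B *v x = pmat ([:0, 1:] ^ (J - i)) B *v (pmat ([:0, 1:] ^ i) B *v w (0 + i))"
      using i by (simp add: pmat_vec_mult[symmetric] power_add[symmetric])
    also have "\<dots> = pmat ([:0, 1:] ^ (J - i)) B *v w 0" by (simp only: shift)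
    finally have "pmat ([:0, 1:] ^ J) B *v (c *s x + y) =
        pmat (smult c ([:0, 1:] ^ (J - i)) + t) B *v w 0"
      by (simp add: matrix_vector_right_distrib scalar_commute pmat_vec_add pmat_vec_smult t)
    moreover have "coeff (smult c ([:0, 1:] ^ (J - i)) + t) 0 = 0"
      using i(1) by (simp add: t coeff_0_power power_0_left)
    ultimately show ?case by blast
  qed
  from this[OF J] obtain t where t: "coeff t 0 = 0"
    "pmat ([:0, 1:] ^ J) B *v w J = pmat t B *v w 0" by blast
  then have "w 0 = pmat t B *v w 0" using shift[of J 0] by simp
  then have "pmat (1 + smult (-1) t) B *v w 0 = 0"
    by (simp add: pmat_vec_add pmat_vec_smult del: smult_minus_left)
  moreover have "coeff (1 + smult (-1) t) 0 = 1" using t by simp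
  ultimately show ?thesis by (rule that[rotated])
qed

text \<open>Strip all factors \<open>x - 1\<close> from the annihilator. What remains cannot annihilate a nonzero vector, since
that would yield a unimodular divisor of \<open>g\<close>.\<close>

lemma divisible_imp_unipotent:
  fixes A :: "int^'n^'n" and w :: "nat \<Rightarrow> int^'n"
  assumes "charpoly A = [:1, -1:] ^ k * g" "\<nexists>p. unimodular_poly p \<and> p dvd g"
    and w: "\<And>j. w j = transpose A *v w (Suc j)"
  shows "\<exists>r. ((\<lambda>v. transpose A *v v - v) ^^ r) (w 0) = 0"
proof -
  let ?B = "transpose A"
  obtain s where s: "coeff s 0 = 1" "pmat s ?B *v w 0 = 0"
    using divisible_orbit_annihilator[of w ?B] w by blast
  have "s \<noteq> 0" using s(1) by auto
  then obtain s' where s': "s = [:-1, 1:] ^ order 1 s * s'" "\<not> [:-1, 1:] dvd s'"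
    using order_decomp by blast
  have "poly s' 1 \<noteq> 0" using s'(2) by (simp add: poly_eq_0_iff_dvd)
  moreover have "coeff s' 0 \<in> {-1, 1}"
  proof -
    have "coeff s' 0 dvd coeff s 0" by (subst s'(1)) (simp add: coeff_mult)
    then show ?thesis using s(1) by (auto simp: abs_if split: if_splits)
  qed
  moreover have "pmat s' ?B *v (pmat ([:-1, 1:] ^ order 1 s) ?B *v w 0) = 0"
    using s(2) by (subst (asm) s'(1)) (simp add: pmat_vec_mult pmat_vec_mult')
  ultimately have "pmat ([:-1, 1:] ^ order 1 s) ?B *v w 0 = 0"
    using unimodular_factor_from_annihilator[OF assms(1)] assms(2) by blast
  moreover have "(\<lambda>v. pmat [:-1, 1:] ?B *v v) = (\<lambda>v. ?B *v v - v)"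
    by (simp add: pmat_vec_pCons vec_eq_iff)
  ultimately show ?thesis
    unfolding pmat_vec_power by metis
qed

section \<open>The torus and lifts of affine maps\<close>

definition tor :: "real^'n \<Rightarrow> complex^'n" where
  "tor x = (\<chi> i. ec (x $ i))"

lemma tor_in_torus [simp]: "tor x \<in> torus"
  by (simp add: tor_def torus_def)

lemma torus_eq_tor_image: "t \<in> torus \<Longrightarrow> \<exists>x\<in>cbox 0 1. t = tor x"
proof -
  assume t: "t \<in> torus"
  have "\<exists>s. 0 \<le> s \<and> s \<le> 1 \<and> t $ i = ec s" for i
  proof -
    have "norm (t $ i) = 1" using t by (simp add: torus_def)
    then obtain a where a: "0 \<le> a" "a < 2 * pi" "t $ i = Complex (cos a) (sin a)"
      by (rule complex_unimodular_polar)
    then show ?thesis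
      by (intro exI[of _ "a / (2 * pi)"]) (auto simp: ec_def cis.ctr)
  qed
  then obtain s where s: "\<And>i. 0 \<le> s i" "\<And>i. s i \<le> 1" "\<And>i. t $ i = ec (s i)" by metis
  show ?thesis
    by (rule bexI[of _ "\<chi> i. s i"]) (auto simp: tor_def vec_eq_iff s mem_box_cart)
qed

lemma torusE:
  assumes "t \<in> torus" obtains x where "t = tor x"
  using torus_eq_tor_image[OF assms] by blast

lemma continuous_on_tor [continuous_intros]:
  "continuous_on S f \<Longrightarrow> continuous_on S (\<lambda>x. tor (f x))"
  unfolding tor_def by (intro continuous_intros)

lemma tor_mult: "tor x \<otimes>\<^bsub>torus_group\<^esub> tor y = tor (x + y)"
  by (simp add: torus_group_def tor_def ec_add vec_eq_iff)

lemma tor_inv: "inv\<^bsub>torus_group\<^esub> (tor x) = tor (- x)"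
proof -
  interpret comm_group "torus_group :: (complex^'a) monoid" by (rule comm_group_torus_group)
  show ?thesis
  proof (rule inv_equality)
    show "tor (- x) \<otimes>\<^bsub>torus_group\<^esub> tor x = \<one>\<^bsub>torus_group\<^esub>"
      unfolding tor_mult by (simp add: torus_group_def tor_def vec_eq_iff)
  qed (simp_all add: torus_group_def)
qed

lemma torus_endo_tor: "torus_endo A (tor x) = tor (of_int_mat A *v x)"
  by (simp add: torus_endo_def tor_def of_int_mat_def matrix_vector_mult_def ec_sum ec_powi)

definition int_vec :: "real^'n \<Rightarrow> bool" where
  "int_vec z \<longleftrightarrow> (\<forall>i. z $ i \<in> \<int>)"

lemma tor_eq_iff: "tor x = tor y \<longleftrightarrow> int_vec (x - y)"
  by (simp add: tor_def vec_eq_iff ec_eq_iff int_vec_def)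

lemma int_vec_sum: "(\<And>i. i \<in> I \<Longrightarrow> int_vec (f i)) \<Longrightarrow> int_vec (\<Sum>i\<in>I. f i)"
  by (auto simp: int_vec_def intro!: Ints_sum)

lemma int_vec_of_nat_scaleR: "int_vec x \<Longrightarrow> int_vec (real n *\<^sub>R x)"
  by (simp add: int_vec_def)

lemma int_vec_mat: "int_vec x \<Longrightarrow> int_vec (of_int_mat A *v x)"
  by (auto simp: int_vec_def of_int_mat_def matrix_vector_mult_def intro!: Ints_sum)

lemma dot_int_vec: "int_vec x \<Longrightarrow> dot m x \<in> \<int>"
  by (auto simp: int_vec_def dot_def intro!: Ints_sum)

lemma dot_axis: "dot m (axis i 1) = of_int (m $ i)"
  by (simp add: dot_def axis_def if_distrib cong: if_cong)

lemma dot_eqI: "(\<And>x. dot m x = dot m' x) \<Longrightarrow> m = m'"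
  using dot_axis by (metis of_int_eq_iff vec_eq_iff)

lemma dot_inner: "dot m x = of_int_vec m \<bullet> x"
  by (simp add: dot_def of_int_vec_def inner_vec_def)

lemma dot_transpose: "dot (transpose A *v m) x = dot m (of_int_mat A *v x)"
proof -
  have "dot (transpose A *v m) x = (transpose (of_int_mat A) *v of_int_vec m) \<bullet> x"
    by (simp only: dot_inner of_int_vec_mult transpose_of_int_mat)
  also have "\<dots> = dot m (of_int_mat A *v x)"
    by (simp add: dot_inner dot_lmul_matrix)
  finally show ?thesis .
qed

lemma dot_eq_half:
  assumes "m \<noteq> 0"
  obtains x where "dot m x = 1 / 2"
proof -
  obtain i where i: "m $ i \<noteq> 0" using assms by (auto simp: vec_eq_iff)
  show ?thesis
    by (rule that[of "(1 / (2 * of_int (m $ i))) *\<^sub>R axis i 1"]) (use i in \<open>simp add: dot_scaleR dot_axis\<close>)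
qed

lemma half_notin_Ints: "(1 / 2 :: real) \<notin> \<int>"
proof
  assume "(1 / 2 :: real) \<in> \<int>"
  then obtain n :: int where "1 / 2 = real_of_int n" by (auto elim: Ints_cases)
  then have "real_of_int (2 * n) = real_of_int 1" by simp
  then have "2 * n = 1" unfolding of_int_eq_iff .
  then show False by presburger
qed

definition torus_char :: "int^'n \<Rightarrow> complex^'n \<Rightarrow> complex" where
  "torus_char m t = (\<Prod>i\<in>UNIV. t $ i powi (m $ i))"

lemma torus_char_tor: "torus_char m (tor x) = ec (dot m x)"
  by (simp add: torus_char_def tor_def dot_def ec_powi ec_sum)

lemma continuous_on_torus_char: "continuous_on torus (torus_char m)"
  unfolding torus_char_def
  by (intro continuous_intros) (auto simp: torus_def, metis norm_zero zero_neq_one)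

lemma openin_torus_char_neq:
  "openin (top_of_set torus) {t \<in> torus. torus_char m t \<noteq> c}"
proof -
  have "{t \<in> torus. torus_char m t \<noteq> c} = torus \<inter> torus_char m -` (- {c})" by auto
  then show ?thesis
    using continuous_openin_preimage_gen[OF continuous_on_torus_char, of "- {c}" m] by (simp add: open_Compl)
qed

lemma torus_char_neq_nonempty:
  assumes "m \<noteq> 0"
  shows "{t \<in> torus. torus_char m t \<noteq> ec s} \<noteq> {}"
proof -
  obtain x where x: "dot m x = 1 / 2" using dot_eq_half[OF assms] .
  have "torus_char m (tor x) \<noteq> torus_char m (tor 0)"
    by (simp add: torus_char_tor x ec_eq_1_iff half_notin_Ints)
  then have "torus_char m (tor x) \<noteq> ec s \<or> torus_char m (tor 0) \<noteq> ec s" by metis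
  then show ?thesis using tor_in_torus by blast
qed

text \<open>Neighbourhoods on the torus in the form in which concentration produces points.\<close>

lemma torus_nhd_contains_box:
  assumes "openin (top_of_set torus) V" "tor q \<in> V"
  obtains e where "e > 0" "\<And>x. (\<And>i. norm (ec (x $ i) - ec (q $ i)) < e) \<Longrightarrow> tor x \<in> V"
proof -
  obtain e where e: "e > 0" "ball (tor q) e \<inter> torus \<subseteq> V"
    using assms unfolding openin_contains_ball by blast
  show ?thesis
  proof (rule that[of "e / CARD('a)"])
    show "e / real CARD('a) > 0" using e(1) by simp
  next
    fix x assume x: "\<And>i. norm (ec (x $ i) - ec (q $ i)) < e / CARD('a)"
    have "norm (tor x - tor q) \<le> (\<Sum>i\<in>UNIV. norm ((tor x - tor q) $ i))"
      unfolding norm_vec_def by (rule L2_set_le_sum) auto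
    also have "\<dots> < (\<Sum>i\<in>(UNIV::'a set). e / CARD('a))"
      by (rule sum_strict_mono) (use x in \<open>auto simp: tor_def\<close>)
    also have "\<dots> = e" by simp
    finally have "tor x \<in> ball (tor q) e" by (simp add: dist_norm norm_minus_commute)
    then show "tor x \<in> V" using e(2) by auto
  qed
qed

text \<open>The lift \<open>l\<close> of the translation part is determined only up to integer vectors; fixing one makes
inverse iterates available as affine maps of the real vector space.\<close>

definition torus_affine :: "int^'n^'n \<Rightarrow> real^'n \<Rightarrow> (complex^'n \<Rightarrow> complex^'n) \<Rightarrow> bool" where
  "torus_affine A l T \<longleftrightarrow> (\<forall>x. T (tor x) = tor (of_int_mat A *v x + l))"

lemma affine_map_of_iff: "affine_map_of A T \<longleftrightarrow> (\<exists>l. torus_affine A l T)"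
proof
  assume "affine_map_of A T"
  then obtain \<mu> where \<mu>: "\<mu> \<in> torus" "\<And>x. x \<in> torus \<Longrightarrow> T x = \<mu> \<otimes>\<^bsub>torus_group\<^esub> torus_endo A x"
    by (auto simp: affine_map_of_def)
  obtain l where "\<mu> = tor l" using torusE[OF \<mu>(1)] .
  then show "\<exists>l. torus_affine A l T"
    using \<mu>(2) by (auto simp: torus_affine_def torus_endo_tor tor_mult add.commute)
next
  assume "\<exists>l. torus_affine A l T"
  then obtain l where l: "torus_affine A l T" by blast
  show "affine_map_of A T"
    unfolding affine_map_of_def
  proof (rule bexI[of _ "tor l"], intro ballI)
    fix t :: "complex^'a" assume "t \<in> torus"
    then obtain x where "t = tor x" by (rule torusE)
    then show "T t = tor l \<otimes>\<^bsub>torus_group\<^esub> torus_endo A t"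
      using l by (simp add: torus_affine_def torus_endo_tor tor_mult add.commute)
  qed simp
qed

abbreviation lift_map :: "int^'n^'n \<Rightarrow> real^'n \<Rightarrow> real^'n \<Rightarrow> real^'n" where
  "lift_map A l \<equiv> (\<lambda>x. of_int_mat A *v x + l)"

lemma torus_affine_iterate:
  assumes "torus_affine A l T"
  shows "(T ^^ i) (tor x) = tor ((lift_map A l ^^ i) x)"
  using assms by (induction i) (auto simp: torus_affine_def)

lemma torus_affine_iterate_image_subset:
  assumes "torus_affine A l T" "V \<subseteq> torus"
  shows "(T ^^ i) ` V \<subseteq> torus"
proof (rule image_subsetI)
  fix t assume "t \<in> V"
  then obtain x where "t = tor x" using assms(2) torusE by blast
  then show "(T ^^ i) t \<in> torus" using torus_affine_iterate[OF assms(1)] by simp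
qed

lemma lift_map_iterate_add:
  "(lift_map A l ^^ i) (x + y) = (lift_map A l ^^ i) x + (((*v) (of_int_mat A)) ^^ i) y"
  by (induction i) (auto simp: matrix_vector_right_distrib)

lemma linear_matrix_iterate: "linear (((*v) (M :: real^'n^'n)) ^^ i)"
proof (induction i)
  case 0
  show ?case by (simp add: linear_id[unfolded id_def])
next
  case (Suc i)
  show ?case unfolding funpow.simps by (rule linear_compose[OF Suc.IH matrix_vector_mul_linear])
qed

lemma int_vec_mat_iterate:
  fixes A :: "int^'n^'n"
  shows "int_vec x \<Longrightarrow> int_vec ((((*v) (of_int_mat A)) ^^ i) x)"
  by (induction i) (simp_all add: int_vec_mat)

lemma real_inverse_of_int_mat:
  assumes "det (A :: int^'n^'n) \<noteq> 0"
  obtains R :: "real^'n^'n" where "\<And>x. of_int_mat A *v (R *v x) = x" "\<And>x. R *v (of_int_mat A *v x) = x"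
proof -
  have "invertible (of_int_mat A :: real^'n^'n)"
    using assms by (simp add: invertible_det_nz det_of_int_mat)
  then obtain R :: "real^'n^'n" where R: "of_int_mat A ** R = mat 1" "R ** of_int_mat A = mat 1"
    unfolding invertible_def by blast
  show ?thesis by (rule that[of R]) (simp_all add: matrix_vector_mul_assoc R)
qed

lemma funpow_inverse_cancel:
  assumes "\<And>x. f (g x) = x" "j \<le> N"
  shows "(f ^^ N) ((g ^^ j) x) = (f ^^ (N - j)) x"
  using assms(2)
proof (induction j arbitrary: x)
  case (Suc j)
  then have "(f ^^ N) ((g ^^ Suc j) x) = (f ^^ (N - j)) (g x)"
    by (simp add: funpow_swap1)
  also have "N - j = Suc (N - Suc j)" using Suc.prems by simp
  also have "(f ^^ Suc (N - Suc j)) (g x) = (f ^^ (N - Suc j)) x"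
    by (simp only: funpow_Suc_right o_apply assms(1))
  finally show ?case .
qed simp

section \<open>Exactness\<close>

text \<open>The coordinates of \<open>w\<^sub>j\<close> are the values of \<open>m\<close> on \<open>A\<^bsup>-j\<^esup>\<close> applied to the unit vectors, which are
integers by hypothesis; so \<open>w\<^sub>j\<close> is \<open>B\<^bsup>-j\<^esup> m\<close>.\<close>

lemma persistent_integrality_gives_sequence:
  fixes A :: "int^'n^'n" and R :: "real^'n^'n"
  assumes R: "\<And>x. of_int_mat A *v (R *v x) = x" "\<And>x. R *v (of_int_mat A *v x) = x"
    and int: "\<And>j z. int_vec z \<Longrightarrow> dot m ((((*v) R) ^^ j) z) \<in> \<int>"
  obtains w where "w 0 = m" "\<And>j. w j = transpose A *v w (Suc j)"
proof -
  have "\<exists>c::int. dot m ((((*v) R) ^^ j) (axis i 1)) = of_int c" for j i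
  proof -
    have "int_vec (axis i 1)" by (simp add: int_vec_def axis_def)
    from int[OF this, of j] show ?thesis by (auto elim: Ints_cases)
  qed
  then obtain c where c: "\<And>j i. dot m ((((*v) R) ^^ j) (axis i 1)) = of_int (c j i)" by metis
  define w where "w j = (\<chi> i. c j i)" for j
  have w: "dot (w j) x = dot m ((((*v) R) ^^ j) x)" for j x
  proof -
    have "x = (\<Sum>i\<in>UNIV. x $ i *\<^sub>R axis i 1)"
      by (simp add: vec_eq_iff axis_def if_distrib cong: if_cong)
    then have "(((*v) R) ^^ j) x = (\<Sum>i\<in>UNIV. x $ i *\<^sub>R (((*v) R) ^^ j) (axis i 1))"
      using linear_sum[OF linear_matrix_iterate] linear_cmul[OF linear_matrix_iterate]
      by (metis (no_types, lifting) sum.cong)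
    then show ?thesis
      by (simp add: dot_sum dot_scaleR c) (simp add: dot_def w_def mult.commute)
  qed
  show ?thesis
  proof (rule that)
    show "w 0 = m" by (rule dot_eqI) (simp add: w)
    fix j show "w j = transpose A *v w (Suc j)"
      by (rule dot_eqI) (simp only: w dot_transpose funpow_Suc_right o_apply R)
  qed
qed

lemma character_detected_by_preimages_of_0:
  fixes A :: "int^'n^'n" and R :: "real^'n^'n"
  assumes "charpoly A = [:1, -1:] ^ k * g" "\<nexists>p. unimodular_poly p \<and> p dvd g"
    and "\<And>x. of_int_mat A *v (R *v x) = x" "\<And>x. R *v (of_int_mat A *v x) = x"
    and "\<And>r. ((\<lambda>v. transpose A *v v - v) ^^ r) m \<noteq> 0"
  shows "\<exists>j z. int_vec z \<and> dot m ((((*v) R) ^^ j) z) \<notin> \<int>"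
proof (rule ccontr)
  assume neg: "\<not> ?thesis"
  have "dot m ((((*v) R) ^^ j) z) \<in> \<int>" if "int_vec z" for j z
    using neg that by blast
  then obtain w where w: "w 0 = m" "\<And>j. w j = transpose A *v w (Suc j)"
    using persistent_integrality_gives_sequence[OF assms(3,4), where m = m] by metis
  show False
    using divisible_imp_unipotent[OF assms(1,2), of w] w(2) assms(5) unfolding w(1) by blast
qed

text \<open>For finitely many characters a single \<open>N\<close> suffices to detect them by points of \<open>A\<^bsup>-N\<^esup> \<int>\<^sup>n\<close>. Adding
such points to a lift of a preimage under the \<open>N\<close>-th iterate gives further preimages, and by concentration one of them
lies in \<open>V\<close>. Here \<open>N\<close> depends on \<open>V\<close> but not on the target point.\<close>

lemma exact_if_characters_detected:
  fixes A :: "int^'n^'n" and R :: "real^'n^'n"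
  assumes R: "\<And>x. of_int_mat A *v (R *v x) = x"
    and T: "torus_affine A l T"
    and detect: "\<And>m. m \<noteq> 0 \<Longrightarrow> \<exists>j z. int_vec z \<and> dot m ((((*v) R) ^^ j) z) \<notin> \<int>"
  shows "exact_on torus T"
  unfolding exact_on_def
proof (intro allI impI)
  fix V :: "(complex^'n) set"
  assume V: "openin (top_of_set torus) V \<and> V \<noteq> {}"
  then have Vsub: "V \<subseteq> torus" using openin_imp_subset by blast
  obtain t where "t \<in> V" using V by blast
  then obtain q where q: "tor q \<in> V" using Vsub torusE by blast
  obtain e where e: "e > 0" "\<And>x. (\<And>i. norm (ec (x $ i) - ec (q $ i)) < e) \<Longrightarrow> tor x \<in> V"
    using torus_nhd_contains_box[OF conjunct1[OF V] q] by blast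
  show "\<exists>N. (T ^^ N) ` V = torus"
  proof (rule trig_poly_concentration[where 'b = "int^'n \<Rightarrow> nat" and 'n = 'n, OF e(1)])
    fix F :: "(int^'n) set" and \<delta> :: real
    assume F: "finite F" "0 \<notin> F" "\<delta> > 0"
      and conc: "\<And>(I :: (int^'n \<Rightarrow> nat) set) p q. \<lbrakk>finite I; I \<noteq> {};
          \<And>m. m \<in> F \<Longrightarrow> norm (\<Sum>l\<in>I. ec (dot m (p l))) \<le> \<delta> * real (card I)\<rbrakk>
          \<Longrightarrow> \<exists>l\<in>I. \<forall>i. norm (ec (p l $ i) - ec (q $ i)) < e"
    have "\<forall>m\<in>F. \<exists>j z. int_vec z \<and> dot m ((((*v) R) ^^ j) z) \<notin> \<int>"
      using detect F(2) by metis
    then obtain j z where jz: "\<And>m. m \<in> F \<Longrightarrow> int_vec (z m)"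
      "\<And>m. m \<in> F \<Longrightarrow> dot m ((((*v) R) ^^ j m) (z m)) \<notin> \<int>"
      by metis
    define N where "N = (\<Sum>m\<in>F. j m)"
    have jN: "j m \<le> N" if "m \<in> F" for m
      unfolding N_def using F(1) that by (intro member_le_sum) auto
    define G where "G m = (((*v) R) ^^ j m) (z m)" for m
    obtain I where I: "finite I" "I \<noteq> {}"
      "\<And>m. m \<in> F \<Longrightarrow> norm (\<Sum>a\<in>I. ec (dot m (\<Sum>m'\<in>F. real (a m') *\<^sub>R G m'))) \<le> \<delta> * real (card I)"
      using group_average_small[OF F(1,3) jz(2)] unfolding G_def[symmetric] by blast
    \<comment> \<open>Lifts of preimages of the identity: the \<open>N\<close>-th power of \<open>A\<close> maps them to integer vectors.\<close>
    define S where "S a = (\<Sum>m'\<in>F. real (a m') *\<^sub>R G m')" for a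
    have S: "int_vec ((((*v) (of_int_mat A)) ^^ N) (S a))" for a
      unfolding S_def linear_sum[OF linear_matrix_iterate] linear_cmul[OF linear_matrix_iterate]
    proof (intro int_vec_sum int_vec_of_nat_scaleR)
      fix m assume "m \<in> F"
      then show "int_vec ((((*v) (of_int_mat A)) ^^ N) (G m))"
        unfolding G_def
        by (subst funpow_inverse_cancel[where f = "(*v) (of_int_mat A)" and g = "(*v) R", OF R jN])
           (auto intro: int_vec_mat_iterate jz)
    qed
    have "torus \<subseteq> (T ^^ N) ` V"
    proof
      fix t :: "complex^'n" assume "t \<in> torus"
      then obtain y where y: "t = tor y" by (rule torusE)
      define x0 where "x0 = ((\<lambda>y. R *v (y - l)) ^^ N) y"
      have x0: "(lift_map A l ^^ N) x0 = y"
        unfolding x0_def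
        by (subst funpow_inverse_cancel[where f = "lift_map A l" and g = "\<lambda>y. R *v (y - l)"]) (simp_all add: R)
      have "norm (\<Sum>a\<in>I. ec (dot m (x0 + S a))) \<le> \<delta> * real (card I)" if "m \<in> F" for m
        using I(3)[OF that] by (simp add: S_def dot_add ec_add sum_distrib_left[symmetric] norm_mult)
      then obtain a where a: "\<And>i. norm (ec ((x0 + S a) $ i) - ec (q $ i)) < e"
        using conc[OF I(1,2), of "\<lambda>a. x0 + S a" q] by blast
      then have "tor (x0 + S a) \<in> V" by (rule e(2))
      moreover have "(T ^^ N) (tor (x0 + S a)) = t"
        unfolding torus_affine_iterate[OF T] lift_map_iterate_add x0 y
        using S[of a] by (simp add: tor_eq_iff)
      ultimately show "t \<in> (T ^^ N) ` V" by blast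
    qed
    then show "\<exists>N. (T ^^ N) ` V = torus"
      using torus_affine_iterate_image_subset[OF T Vsub] by blast
  qed
qed

section \<open>Dense backward orbits and strong transitivity\<close>

text \<open>Along a backward orbit, \<open>m \<bullet> x\<^sub>j = (B m) \<bullet> x\<^bsub>j+1\<^esub> + m \<bullet> l\<close>. So one multiplicative difference replaces
\<open>m\<close> by \<open>-(B - 1) m\<close>, up to a shift of the orbit and a constant factor. The shift \<open>b\<close> and the factor \<open>c\<close> are
in the statement for the sake of the induction.\<close>

lemma backward_orbit_phase:
  fixes A :: "int^'n^'n" and x :: "nat \<Rightarrow> real^'n"
  assumes x: "\<And>j. x j = lift_map A l (x (Suc j))"
    and C: "C = (\<lambda>v. transpose A *v v - v)" "(C ^^ Suc s) m = 0" and c: "norm c = 1"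
  shows "\<exists>w. (mdiff 1 ^^ Suc s) (\<lambda>j. c * ec (dot m (x (b + j)))) = (\<lambda>_. w) \<and>
           (w = ec (dot ((C ^^ s) m) l) \<or> w = ec (- dot ((C ^^ s) m) l))"
  using C(2) c
proof (induction s arbitrary: m b c)
  have step: "mdiff 1 (\<lambda>j. c * ec (dot m (x (b + j)))) =
      (\<lambda>j. ec (- dot m l) * ec (dot (- C m) (x (Suc b + j))))" if "norm c = 1" for m b and c :: complex
  proof
    fix j
    have c: "c * cnj c = 1" using complex_norm_square[of c] that by simp
    have "dot m (x (b + j)) = dot (transpose A *v m) (x (Suc (b + j))) + dot m l"
      by (subst x) (simp only: dot_add dot_transpose)
    also have "\<dots> = dot (C m) (x (Suc (b + j))) + dot m (x (Suc (b + j))) + dot m l"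
      by (simp add: C(1) dot_diff_left)
    finally have d: "dot m (x (Suc (b + j))) - dot m (x (b + j)) = - dot m l + dot (- C m) (x (Suc (b + j)))"
      by (simp add: dot_minus_left)
    have "mdiff 1 (\<lambda>j. c * ec (dot m (x (b + j)))) j
        = (c * cnj c) * ec (dot m (x (Suc (b + j))) - dot m (x (b + j)))"
      by (simp add: mdiff_def ec_diff)
    also have "\<dots> = ec (- dot m l) * ec (dot (- C m) (x (Suc b + j)))"
      unfolding d c ec_add mult_1_left add_Suc ..
    finally show "mdiff 1 (\<lambda>j. c * ec (dot m (x (b + j)))) j =
        ec (- dot m l) * ec (dot (- C m) (x (Suc b + j)))" .
  qed
  have C_minus: "C (- v) = - C v" for v
    unfolding C(1) by (simp add: matrix_vector_mult_def vec_eq_iff sum_negf)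
  have C_iter_minus: "(C ^^ i) (- v) = - (C ^^ i) v" for i v
    by (induction i) (simp_all add: C_minus)
  {
    case (0 m b c)
    then show ?case
      using step[of c m b] by (intro exI[of _ "ec (- dot m l)"]) simp
  next
    case (Suc s m b c)
    have iter: "(C ^^ i) (- C m) = - (C ^^ Suc i) m" for i
      unfolding C_iter_minus funpow_Suc_right o_apply ..
    have "(C ^^ Suc s) (- C m) = 0"
      unfolding iter Suc.prems(1) by simp
    then obtain w where w: "(mdiff 1 ^^ Suc s) (\<lambda>j. ec (- dot m l) * ec (dot (- C m) (x (Suc b + j)))) = (\<lambda>_. w)"
      "w = ec (dot ((C ^^ s) (- C m)) l) \<or> w = ec (- dot ((C ^^ s) (- C m)) l)"
      using Suc.IH[OF _ norm_ec[of "- dot m l"], of "- C m" "Suc b"] by blast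
    have "(mdiff 1 ^^ Suc (Suc s)) (\<lambda>j. c * ec (dot m (x (b + j)))) = (\<lambda>_. w)"
      unfolding funpow_Suc_right[of "Suc s"] o_apply step[OF Suc.prems(2)] w(1) ..
    then show ?case
      using w(2) unfolding iter dot_minus_left minus_minus by blast
  }
qed

text \<open>The dual form of the condition that \<open>tor l\<close> and the elements \<open>x\<^sup>-\<^sup>1 \<phi>(x)\<close> generate a dense subgroup;
see \<open>closed_subgroup_generated_eq_torus_iff\<close>.\<close>

definition moves_invariant_characters :: "int^'n^'n \<Rightarrow> real^'n \<Rightarrow> bool" where
  "moves_invariant_characters A l \<longleftrightarrow> (\<forall>m. m \<noteq> 0 \<longrightarrow> transpose A *v m = m \<longrightarrow> dot m l \<notin> \<int>)"

text \<open>The last nonzero vector \<open>m' = (B - 1)\<^sup>s m\<close> is invariant, and so are its multiples; therefore \<open>e(m' \<bullet> l)\<close>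
is not a root of unity and Weyl's theorem applies.\<close>

lemma unipotent_phase_average:
  fixes A :: "int^'n^'n" and x :: "nat \<Rightarrow> real^'n"
  assumes x: "\<And>j. x j = lift_map A l (x (Suc j))"
    and l: "moves_invariant_characters A l"
    and m: "m \<noteq> 0" "((\<lambda>v. transpose A *v v - v) ^^ r) m = 0"
  shows "(\<lambda>L. (\<Sum>j<L. ec (dot m (x (b + j)))) / of_nat L) \<longlonglongrightarrow> 0"
proof -
  define C where "C = (\<lambda>v. transpose A *v v - v)"
  define s where "s = (LEAST s. (C ^^ s) m = 0)"
  have s0: "(C ^^ s) m = 0"
    unfolding s_def by (rule LeastI[of _ r]) (use m(2) in \<open>simp add: C_def\<close>)
  have "s \<noteq> 0" using s0 m(1) by (metis funpow_0)
  then obtain s' where s': "s = Suc s'" by (cases s) auto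
  define m' where "m' = (C ^^ s') m"
  have "m' \<noteq> 0" unfolding m'_def using not_less_Least[of s' "\<lambda>s. (C ^^ s) m = 0"] s' s_def by auto
  have "C m' = 0" using s0 by (simp add: s' m'_def)
  then have fixed: "transpose A *v m' = m'" by (simp add: C_def)
  have irr: "real n * dot m' l \<notin> \<int>" if "n > 0" for n
  proof -
    have "transpose A *v (int n *s m') = int n *s m'" by (simp only: scalar_commute fixed)
    moreover have "int n *s m' \<noteq> 0" using \<open>m' \<noteq> 0\<close> that by (auto simp: vec_eq_iff)
    ultimately have "dot (int n *s m') l \<notin> \<int>" using l unfolding moves_invariant_characters_def by blast
    then show ?thesis by (simp add: dot_smult_left)
  qed
  obtain w where w: "(mdiff 1 ^^ Suc s') (\<lambda>j. 1 * ec (dot m (x (b + j)))) = (\<lambda>_. w)"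
    "w = ec (dot m' l) \<or> w = ec (- dot m' l)"
    using backward_orbit_phase[where x = x and A = A and l = l, OF x C_def s0[unfolded s'] norm_one, of b] unfolding m'_def by blast
  have "w ^ n \<noteq> 1" if "n > 0" for n
    using w(2)
  proof
    assume "w = ec (dot m' l)"
    then show ?thesis using irr[OF that] by (simp add: ec_of_nat_mult[symmetric] ec_eq_1_iff)
  next
    assume "w = ec (- dot m' l)"
    then show ?thesis using irr[OF that] by (simp add: ec_of_nat_mult[symmetric] ec_eq_1_iff)
  qed
  then show ?thesis
    using w(1) by (intro Weyl_average_tendsto_0[where r = s' and w = w]) simp_all
qed

text \<open>Characters that are not unipotent are averaged out over points of \<open>A\<^bsup>-N\<^esup> \<int>\<^sup>n\<close>, the unipotent ones over
the times \<open>N, \<dots>, N + L - 1\<close> of a backward orbit of \<open>y\<close>. At these times adding a point of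
\<open>A\<^bsup>-N\<^esup> \<int>\<^sup>n\<close> still gives a preimage of \<open>y\<close>, so both averages can be taken together, and the character
sums factor.\<close>

lemma backward_orbit_dense:
  fixes A :: "int^'n^'n" and R :: "real^'n^'n"
  assumes charpoly: "charpoly A = [:1, -1:] ^ k * g" "\<nexists>p. unimodular_poly p \<and> p dvd g"
    and R: "\<And>x. of_int_mat A *v (R *v x) = x" "\<And>x. R *v (of_int_mat A *v x) = x"
    and l: "moves_invariant_characters A l" and e: "e > 0"
  shows "\<exists>N x. (\<forall>i. norm (ec (x $ i) - ec (q $ i)) < e) \<and> int_vec ((lift_map A l ^^ N) x - y)"
proof (rule trig_poly_concentration[where 'b = "nat \<times> (int^'n \<Rightarrow> nat)" and 'n = 'n, OF e])
  fix F :: "(int^'n) set" and \<delta> :: real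
  assume F: "finite F" "0 \<notin> F" "\<delta> > 0"
    and conc: "\<And>(I :: (nat \<times> (int^'n \<Rightarrow> nat)) set) p q. \<lbrakk>finite I; I \<noteq> {};
        \<And>m. m \<in> F \<Longrightarrow> norm (\<Sum>l\<in>I. ec (dot m (p l))) \<le> \<delta> * real (card I)\<rbrakk>
        \<Longrightarrow> \<exists>l\<in>I. \<forall>i. norm (ec (p l $ i) - ec (q $ i)) < e"
  define F1 where "F1 = {m \<in> F. \<forall>r. ((\<lambda>v. transpose A *v v - v) ^^ r) m \<noteq> 0}"
  have F1: "finite F1" using F(1) by (simp add: F1_def)
  have "\<exists>j z. int_vec z \<and> dot m ((((*v) R) ^^ j) z) \<notin> \<int>" if "m \<in> F1" for m
    by (rule character_detected_by_preimages_of_0[OF charpoly R]) (use that in \<open>simp_all only: F1_def mem_Collect_eq not_False_eq_True\<close>)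
  then have "\<forall>m\<in>F1. \<exists>j z. int_vec z \<and> dot m ((((*v) R) ^^ j) z) \<notin> \<int>" by blast
  then obtain j z where jz: "\<And>m. m \<in> F1 \<Longrightarrow> int_vec (z m)"
    "\<And>m. m \<in> F1 \<Longrightarrow> dot m ((((*v) R) ^^ j m) (z m)) \<notin> \<int>"
    by metis
  define N where "N = (\<Sum>m\<in>F1. j m)"
  have jN: "j m \<le> N" if "m \<in> F1" for m
    unfolding N_def using F1 that by (intro member_le_sum) auto
  define G where "G m = (((*v) R) ^^ j m) (z m)" for m
  obtain I where I: "finite I" "I \<noteq> {}"
    "\<And>m. m \<in> F1 \<Longrightarrow> norm (\<Sum>a\<in>I. ec (dot m (\<Sum>m'\<in>F1. real (a m') *\<^sub>R G m'))) \<le> \<delta> * real (card I)"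
    using group_average_small[OF F1 F(3) jz(2)] unfolding G_def[symmetric] by blast
  define S where "S a = (\<Sum>m'\<in>F1. real (a m') *\<^sub>R G m')" for a
  have S: "int_vec ((((*v) (of_int_mat A)) ^^ i) (S a))" if "N \<le> i" for a i
    unfolding S_def linear_sum[OF linear_matrix_iterate] linear_cmul[OF linear_matrix_iterate]
  proof (intro int_vec_sum int_vec_of_nat_scaleR)
    fix m assume "m \<in> F1"
    then show "int_vec ((((*v) (of_int_mat A)) ^^ i) (G m))"
      unfolding G_def using jN[of m] that
      by (subst funpow_inverse_cancel[where f = "(*v) (of_int_mat A)" and g = "(*v) R", OF R(1)])
         (auto intro: int_vec_mat_iterate jz)
  qed
  define x where "x i = ((\<lambda>y. R *v (y - l)) ^^ i) y" for i
  have x_step: "x i = lift_map A l (x (Suc i))" for i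
    by (simp add: x_def R)
  have x: "(lift_map A l ^^ i) (x i) = y" for i
    unfolding x_def
    by (subst funpow_inverse_cancel[where f = "lift_map A l" and g = "\<lambda>y. R *v (y - l)"]) (simp_all add: R)
  have "\<forall>m\<in>F - F1. eventually (\<lambda>L. norm ((\<Sum>j<L. ec (dot m (x (N + j)))) / of_nat L) < \<delta>) sequentially"
  proof
    fix m assume m: "m \<in> F - F1"
    then obtain r where "((\<lambda>v. transpose A *v v - v) ^^ r) m = 0" unfolding F1_def by blast
    moreover have "m \<noteq> 0" using m F(2) by blast
    ultimately have "(\<lambda>L. (\<Sum>j<L. ec (dot m (x (N + j)))) / of_nat L) \<longlonglongrightarrow> 0"
      using unipotent_phase_average[where x = x and A = A and l = l, OF x_step l] by blast
    then show "eventually (\<lambda>L. norm ((\<Sum>j<L. ec (dot m (x (N + j)))) / of_nat L) < \<delta>) sequentially"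
      using F(3) by (auto simp: tendsto_iff dist_norm)
  qed
  then have "eventually (\<lambda>L. \<forall>m\<in>F-F1. norm ((\<Sum>j<L. ec (dot m (x (N + j)))) / of_nat L) < \<delta>) sequentially"
    using F(1) by (intro eventually_ball_finite) auto
  then have "eventually (\<lambda>L. L > 0 \<and> (\<forall>m\<in>F-F1. norm ((\<Sum>j<L. ec (dot m (x (N + j)))) / of_nat L) < \<delta>)) sequentially"
    using eventually_gt_at_top[of 0] by eventually_elim simp
  then obtain L where L: "L > 0"
    "\<And>m. m \<in> F - F1 \<Longrightarrow> norm ((\<Sum>j<L. ec (dot m (x (N + j)))) / of_nat L) < \<delta>"
    unfolding eventually_sequentially by blast
  \<comment> \<open>Time averages dispose of the unipotent characters.\<close>
  have time: "norm (\<Sum>j<L. ec (dot m (x (N + j)))) \<le> \<delta> * real L" if "m \<in> F - F1" for m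
    using L(2)[OF that] L(1) by (simp add: norm_divide field_simps)
  \<comment> \<open>The index set combines a time below \<open>L\<close> with a point of \<open>A\<^bsup>-N\<^esup> \<int>\<^sup>n\<close>.\<close>
  define J where "J = {..<L} \<times> I"
  have J: "finite J" "J \<noteq> {}" "real (card J) = real L * real (card I)"
    using I L(1) by (auto simp: J_def card_cartesian_product)
  define p where "p = (\<lambda>(j, a). x (N + j) + S a)"
  have "norm (\<Sum>b\<in>J. ec (dot m (p b))) \<le> \<delta> * real (card J)" if m: "m \<in> F" for m
  proof -
    let ?X = "\<Sum>j<L. ec (dot m (x (N + j)))" and ?Y = "\<Sum>a\<in>I. ec (dot m (S a))"
    have "(\<Sum>b\<in>J. ec (dot m (p b))) = ?X * ?Y"
      unfolding J_def sum_product sum.cartesian_product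
      by (rule sum.cong) (auto simp: p_def dot_add ec_add)
    then have eq: "norm (\<Sum>b\<in>J. ec (dot m (p b))) = norm ?X * norm ?Y" by (simp add: norm_mult)
    have trivial: "norm ?X \<le> real L" "norm ?Y \<le> real (card I)"
      using norm_sum[of "\<lambda>j. ec (dot m (x (N + j)))" "{..<L}"] norm_sum[of "\<lambda>a. ec (dot m (S a))" I]
      by simp_all
    show ?thesis
    proof (cases "m \<in> F1")
      case True
      have "norm ?X * norm ?Y \<le> real L * (\<delta> * real (card I))"
        using I(3)[OF True] trivial F(3) by (intro mult_mono) (auto simp: S_def)
      then show ?thesis unfolding eq J(3) by (simp add: mult_ac)
    next
      case False
      have "norm ?X * norm ?Y \<le> (\<delta> * real L) * real (card I)"
        using time[of m] m False trivial F(3) by (intro mult_mono) auto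
      then show ?thesis unfolding eq J(3) by (simp add: mult_ac)
    qed
  qed
  then obtain b where b: "b \<in> J" "\<And>i. norm (ec (p b $ i) - ec (q $ i)) < e"
    using conc[OF J(1,2), of p q] by blast
  obtain i a where ia: "b = (i, a)" by (cases b)
  have "(lift_map A l ^^ (N + i)) (p b) - y = (((*v) (of_int_mat A)) ^^ (N + i)) (S a)"
    unfolding p_def ia prod.case lift_map_iterate_add x by simp
  then have "int_vec ((lift_map A l ^^ (N + i)) (p b) - y)"
    using S[of "N + i" a] by simp
  with b(2) show ?thesis by blast
qed

text \<open>Every point of the unit cube lies in one of the open sets \<open>U i z\<close> of points whose preimage under the \<open>i\<close>-th
iterate, after translation by the integer vector \<open>z\<close>, is in \<open>V\<close>; by compactness finitely many suffice.\<close>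

lemma strongly_transitive_if_moves_invariant_characters:
  fixes A :: "int^'n^'n" and R :: "real^'n^'n"
  assumes charpoly: "charpoly A = [:1, -1:] ^ k * g" "\<nexists>p. unimodular_poly p \<and> p dvd g"
    and R: "\<And>x. of_int_mat A *v (R *v x) = x" "\<And>x. R *v (of_int_mat A *v x) = x"
    and l: "moves_invariant_characters A l" and T: "torus_affine A l T"
  shows "strongly_transitive_on torus T"
  unfolding strongly_transitive_on_def
proof (intro allI impI)
  fix V :: "(complex^'n) set"
  assume V: "openin (top_of_set torus) V \<and> V \<noteq> {}"
  then have Vsub: "V \<subseteq> torus" using openin_imp_subset by blast
  obtain t where "t \<in> V" using V by blast
  then obtain q where q: "tor q \<in> V" using Vsub torusE by blast
  obtain e where e: "e > 0" "\<And>x. (\<And>i. norm (ec (x $ i) - ec (q $ i)) < e) \<Longrightarrow> tor x \<in> V"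
    using torus_nhd_contains_box[OF conjunct1[OF V] q] by blast
  obtain W where W: "open W" "V = torus \<inter> W"
    using V by (auto simp: openin_open)
  let ?inv = "\<lambda>y. R *v (y - l)"
  define U where "U i z = {y. tor ((?inv ^^ i) (y + z)) \<in> W}" for i and z :: "real^'n"
  have openU: "open (U i z)" for i z
  proof -
    have "continuous_on UNIV (?inv ^^ i)" for i
    proof (induction i)
      case 0
      show ?case by (simp add: continuous_on_id)
    next
      case (Suc i)
      have "continuous_on UNIV (\<lambda>y. R *v ((?inv ^^ i) y - l))"
        by (intro bounded_linear.continuous_on[OF matrix_vector_mul_bounded_linear]
            continuous_on_diff continuous_on_const Suc.IH)
      then show ?case by simp
    qed
    then have "continuous_on UNIV (\<lambda>y. (?inv ^^ i) (y + z))"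
      by (rule continuous_on_compose2) (intro continuous_on_add continuous_on_id continuous_on_const, simp)
    then have "continuous_on UNIV (\<lambda>y. tor ((?inv ^^ i) (y + z)))"
      by (rule continuous_on_tor)
    from open_vimage[OF W(1) this] show ?thesis
      by (simp add: U_def vimage_def)
  qed
  have cover: "y \<in> (\<Union>(i, z)\<in>UNIV \<times> Collect int_vec. U i z)" for y
  proof -
    obtain N x where x: "\<And>i. norm (ec (x $ i) - ec (q $ i)) < e" "int_vec ((lift_map A l ^^ N) x - y)"
      using backward_orbit_dense[OF charpoly R l e(1), of q y] by blast
    let ?z = "(lift_map A l ^^ N) x - y"
    have "(?inv ^^ N) (y + ?z) = x"
      using funpow_inverse_cancel[where f = ?inv and g = "lift_map A l" and N = N and j = N] by (simp add: R)
    moreover have "tor x \<in> W" using e(2)[OF x(1)] W(2) by blast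
    ultimately have "y \<in> U N ?z" by (simp add: U_def)
    with x(2) show ?thesis by blast
  qed
  have "compact (cbox 0 1 :: (real^'n) set)" by (rule compact_cbox)
  then obtain D where D: "D \<subseteq> UNIV \<times> Collect int_vec" "finite D"
    "cbox 0 1 \<subseteq> (\<Union>(i, z)\<in>D. U i z)"
    by (rule compactE_image[where f = "\<lambda>(i, z). U i z" and C = "UNIV \<times> Collect int_vec"])
       (use openU cover in auto)
  \<comment> \<open>Any common bound of the finitely many times will do.\<close>
  define N where "N = (\<Sum>d\<in>D. fst d)"
  have "torus \<subseteq> (\<Union>i\<le>N. (T ^^ i) ` V)"
  proof
    fix t :: "complex^'n" assume "t \<in> torus"
    then obtain y where y: "y \<in> cbox 0 1" "t = tor y" using torus_eq_tor_image by blast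
    obtain i z where iz: "(i, z) \<in> D" "y \<in> U i z" using D(3) y(1) by blast
    have "int_vec z" using D(1) iz(1) by blast
    define x where "x = (?inv ^^ i) (y + z)"
    have "tor x \<in> V" using iz(2) W(2) by (simp add: U_def x_def)
    moreover have "(T ^^ i) (tor x) = t"
    proof -
      have "(lift_map A l ^^ i) x = y + z"
        unfolding x_def
        using funpow_inverse_cancel[where f = "lift_map A l" and g = ?inv and N = i and j = i] by (simp add: R)
      then show ?thesis
        unfolding torus_affine_iterate[OF T] y(2) using \<open>int_vec z\<close> by (simp add: tor_eq_iff)
    qed
    moreover have "i \<le> N"
      unfolding N_def using member_le_sum[of "(i, z)" D fst] iz(1) D(2) by simp
    ultimately show "t \<in> (\<Union>i\<le>N. (T ^^ i) ` V)" by blast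
  qed
  then show "\<exists>N. (\<Union>i\<le>N. (T ^^ i) ` V) = torus"
    using torus_affine_iterate_image_subset[OF T Vsub] by blast
qed

section \<open>Invariant characters as obstructions\<close>

lemma invariant_character_iterate:
  assumes T: "torus_affine A l T" and m: "transpose A *v m = m" and t: "t \<in> torus"
  shows "torus_char m ((T ^^ i) t) = ec (dot m l) ^ i * torus_char m t"
proof -
  obtain x where x: "t = tor x" using t by (rule torusE)
  have "dot m (lift_map A l y) = dot m l + dot m y" for y
    using dot_transpose[of A m y] by (simp add: dot_add m del: transpose_matrix_vector)
  then have "ec (dot m ((lift_map A l ^^ i) x)) = ec (dot m l) ^ i * ec (dot m x)"
    by (induction i) (simp_all add: ec_add)
  then show ?thesis
    by (simp add: x torus_affine_iterate[OF T] torus_char_tor)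
qed

text \<open>An invariant character that is trivial at the translation is constant along orbits, so the open set where it
differs from 1 never covers the identity.\<close>

lemma moves_invariant_characters_if_strongly_transitive:
  fixes A :: "int^'n^'n"
  assumes T: "torus_affine A l T" and st: "strongly_transitive_on torus T"
  shows "moves_invariant_characters A l"
  unfolding moves_invariant_characters_def
proof (intro allI impI notI)
  fix m :: "int^'n"
  assume m: "m \<noteq> 0" "transpose A *v m = m" "dot m l \<in> \<int>"
  define V where "V = {t \<in> torus. torus_char m t \<noteq> ec 0}"
  have "openin (top_of_set torus) V" "V \<noteq> {}"
    unfolding V_def by (rule openin_torus_char_neq, rule torus_char_neq_nonempty[OF m(1)])
  then obtain N where "(\<Union>i\<le>N. (T ^^ i) ` V) = torus"
    using st unfolding strongly_transitive_on_def by blast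
  then obtain i t where it: "t \<in> V" "tor 0 = (T ^^ i) t"
    using tor_in_torus[of 0] by blast
  have "torus_char m (tor 0) = ec (dot m l) ^ i * torus_char m t"
    unfolding it(2) using it(1) by (intro invariant_character_iterate[OF T m(2)]) (simp add: V_def)
  also have "ec (dot m l) = 1" using m(3) by (simp add: ec_eq_1_iff)
  finally show False using it(1) by (simp add: V_def torus_char_tor)
qed

text \<open>The character is multiplied by a constant in each step, so the images of the set where it differs
from 1 never contain the image of the identity.\<close>

lemma not_exact_if_invariant_character:
  fixes A :: "int^'n^'n"
  assumes T: "torus_affine A l T" and m: "m \<noteq> 0" "transpose A *v m = m"
  shows "\<not> exact_on torus T"
proof
  assume ex: "exact_on torus T"
  define V where "V = {t \<in> torus. torus_char m t \<noteq> ec 0}"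
  have "openin (top_of_set torus) V" "V \<noteq> {}"
    unfolding V_def by (rule openin_torus_char_neq, rule torus_char_neq_nonempty[OF m(1)])
  then obtain N where N: "(T ^^ N) ` V = torus"
    using ex unfolding exact_on_def by blast
  have "(T ^^ N) (tor 0) \<in> torus"
    by (simp add: torus_affine_iterate[OF T])
  then obtain t where t: "t \<in> V" "(T ^^ N) (tor 0) = (T ^^ N) t"
    using N by blast
  have "ec (dot m l) ^ N * torus_char m (tor 0) = ec (dot m l) ^ N * torus_char m t"
    using invariant_character_iterate[OF T m(2), of "tor 0" N]
      invariant_character_iterate[OF T m(2), of t N] t by (simp add: V_def)
  then show False using t(1) by (simp add: V_def torus_char_tor)
qed

section \<open>The closed subgroup condition\<close>

lemma torus_char_kernel_subgroup:
  "subgroup {t \<in> torus. torus_char m t = 1} torus_group"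
proof -
  interpret comm_group "torus_group :: (complex^'a) monoid" by (rule comm_group_torus_group)
  show ?thesis
  proof (rule subgroupI)
    show "{t \<in> torus. torus_char m t = 1} \<subseteq> carrier torus_group" by (auto simp: torus_group_def)
    show "{t \<in> torus. torus_char m t = 1} \<noteq> {}"
    proof -
      have "tor 0 \<in> {t \<in> torus. torus_char m t = 1}" by (simp add: torus_char_tor)
      then show ?thesis by blast
    qed
  next
    fix s assume s: "s \<in> {t \<in> torus. torus_char m t = 1}"
    then have "s \<in> torus" by simp
    then obtain x where x: "s = tor x" by (rule torusE)
    have "ec (dot m x) = 1" using s by (simp add: x torus_char_tor)
    then have "ec (dot m (- x)) = 1"
      using dot_diff[of m 0 x] by (simp add: ec_minus)
    then show "inv\<^bsub>torus_group\<^esub> s \<in> {t \<in> torus. torus_char m t = 1}"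
      by (simp add: x tor_inv torus_char_tor)
  next
    fix s t assume st: "s \<in> {t \<in> torus. torus_char m t = 1}" "t \<in> {t \<in> torus. torus_char m t = 1}"
    then have "s \<in> torus" "t \<in> torus" by simp_all
    then obtain x y where xy: "s = tor x" "t = tor y" by (auto elim!: torusE)
    show "s \<otimes>\<^bsub>torus_group\<^esub> t \<in> {t \<in> torus. torus_char m t = 1}"
      using st by (simp add: xy tor_mult torus_char_tor dot_add ec_add)
  qed
qed

lemma torus_char_kernel_closed:
  "closedin (top_of_set torus) {t \<in> torus. torus_char m t = 1}"
proof -
  have "{t \<in> torus. torus_char m t = 1} = torus \<inter> torus_char m -` {1}" by auto
  then show ?thesis
    using continuous_closedin_preimage[OF continuous_on_torus_char, of "{1}" m] by simp
qed

text \<open>Duality for closed subgroups of the torus: multiples of separating points form families in \<open>H\<close> with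
small character averages, so \<open>H\<close> is dense.\<close>

lemma closed_subgroup_eq_torus:
  fixes H :: "(complex^'n) set"
  assumes H: "subgroup H torus_group" "closedin (top_of_set torus) H"
    and sep: "\<And>m. m \<noteq> 0 \<Longrightarrow> \<exists>g. tor g \<in> H \<and> dot m g \<notin> \<int>"
  shows "H = torus"
proof (rule ccontr)
  assume "H \<noteq> torus"
  moreover have "H \<subseteq> torus" using closedin_imp_subset[OF H(2)] .
  ultimately obtain t where t: "t \<in> torus - H" by blast
  then obtain q where q: "t = tor q" using torusE by blast
  have "openin (top_of_set torus) (torus - H)"
    using H(2) by (simp add: closedin_def)
  then obtain e where e: "e > 0" "\<And>x. (\<And>i. norm (ec (x $ i) - ec (q $ i)) < e) \<Longrightarrow> tor x \<in> torus - H"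
    using torus_nhd_contains_box t unfolding q by blast
  interpret H: subgroup H "torus_group :: (complex^'n) monoid" by (rule H(1))
  have one: "\<one>\<^bsub>torus_group\<^esub> = (tor 0 :: complex^'n)"
    by (simp add: torus_group_def tor_def vec_eq_iff)
  have H0: "tor 0 \<in> H" using H.one_closed unfolding one .
  have Hadd: "tor (x + y) \<in> H" if "tor x \<in> H" "tor y \<in> H" for x y
    using H.m_closed[OF that] unfolding tor_mult .
  have Hmult: "tor (real n *\<^sub>R x) \<in> H" if "tor x \<in> H" for n x
    using that by (induction n) (auto simp: H0 Hadd scaleR_left_distrib)
  have Hsum: "tor (\<Sum>m\<in>F. f m) \<in> H" if "\<And>m. m \<in> F \<Longrightarrow> tor (f m) \<in> H" for F :: "(int^'n) set" and f
    using that by (induction F rule: infinite_finite_induct) (auto simp: H0 Hadd)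
  show False
  proof (rule trig_poly_concentration[where 'b = "int^'n \<Rightarrow> nat" and 'n = 'n, OF e(1)])
    fix F :: "(int^'n) set" and \<delta> :: real
    assume F: "finite F" "0 \<notin> F" "\<delta> > 0"
      and conc: "\<And>(I :: (int^'n \<Rightarrow> nat) set) p q. \<lbrakk>finite I; I \<noteq> {};
          \<And>m. m \<in> F \<Longrightarrow> norm (\<Sum>l\<in>I. ec (dot m (p l))) \<le> \<delta> * real (card I)\<rbrakk>
          \<Longrightarrow> \<exists>l\<in>I. \<forall>i. norm (ec (p l $ i) - ec (q $ i)) < e"
    have "\<forall>m\<in>F. \<exists>g. tor g \<in> H \<and> dot m g \<notin> \<int>" using sep F(2) by metis
    then obtain G where G: "\<And>m. m \<in> F \<Longrightarrow> tor (G m) \<in> H" "\<And>m. m \<in> F \<Longrightarrow> dot m (G m) \<notin> \<int>"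
      by metis
    obtain I where I: "finite I" "I \<noteq> {}"
      "\<And>m. m \<in> F \<Longrightarrow> norm (\<Sum>a\<in>I. ec (dot m (\<Sum>m'\<in>F. real (a m') *\<^sub>R G m'))) \<le> \<delta> * real (card I)"
      using group_average_small[OF F(1,3) G(2)] by blast
    obtain a where a: "\<And>i. norm (ec ((\<Sum>m'\<in>F. real (a m') *\<^sub>R G m') $ i) - ec (q $ i)) < e"
      using conc[OF I(1,2), of "\<lambda>a. \<Sum>m'\<in>F. real (a m') *\<^sub>R G m'" q] I(3) by blast
    have "tor (\<Sum>m'\<in>F. real (a m') *\<^sub>R G m') \<in> H" by (intro Hsum Hmult G)
    then show False using e(2)[OF a] by blast
  qed
qed

text \<open>A character is trivial on all \<open>x\<^sup>-\<^sup>1 \<phi>(x)\<close> iff it is invariant, because \<open>m \<bullet> (A x - x) = (B m - m) \<bullet> x\<close>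
takes non-integral values unless \<open>B m = m\<close>.\<close>

lemma closed_subgroup_generated_eq_torus_iff:
  fixes A :: "int^'n^'n"
  shows "closed_subgroup_generated
      (insert (tor l) {inv\<^bsub>torus_group\<^esub> x \<otimes>\<^bsub>torus_group\<^esub> torus_endo A x | x. x \<in> torus}) = torus
    \<longleftrightarrow> moves_invariant_characters A l"
proof -
  define M where "M = {inv\<^bsub>torus_group\<^esub> x \<otimes>\<^bsub>torus_group\<^esub> torus_endo A x | x. x \<in> torus}"
  have M_eq: "M = range (\<lambda>x. tor (of_int_mat A *v x - x))"
  proof -
    have eq: "inv\<^bsub>torus_group\<^esub> (tor x) \<otimes>\<^bsub>torus_group\<^esub> torus_endo A (tor x) = tor (of_int_mat A *v x - x)" for x
      by (simp add: tor_inv torus_endo_tor tor_mult)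
    have range: "(torus :: (complex^'n) set) = range tor" by (auto elim: torusE)
    show ?thesis unfolding M_def Setcompr_eq_image range image_image eq ..
  qed
  have dotM: "dot m (of_int_mat A *v x - x) = dot (transpose A *v m - m) x" for m x
    by (simp only: dot_diff dot_diff_left dot_transpose)
  show ?thesis
    unfolding M_def[symmetric]
  proof
    assume gen: "closed_subgroup_generated (insert (tor l) M) = torus"
    show "moves_invariant_characters A l"
      unfolding moves_invariant_characters_def
    proof (intro allI impI notI)
      fix m :: "int^'n"
      assume m: "m \<noteq> 0" "transpose A *v m = m" "dot m l \<in> \<int>"
      have "insert (tor l) M \<subseteq> {t \<in> torus. torus_char m t = 1}"
        using m(3) unfolding M_eq by (auto simp: torus_char_tor ec_eq_1_iff dotM m(2) simp del: transpose_matrix_vector)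
      then have "closed_subgroup_generated (insert (tor l) M) \<subseteq> {t \<in> torus. torus_char m t = 1}"
        unfolding closed_subgroup_generated_def
        using torus_char_kernel_subgroup torus_char_kernel_closed by blast
      then show False
        using torus_char_neq_nonempty[OF m(1), of 0] unfolding gen by auto
    qed
  next
    assume l: "moves_invariant_characters A l"
    have eq: "H = torus" if H: "subgroup H torus_group" "closedin (top_of_set torus) H" "insert (tor l) M \<subseteq> H" for H
    proof (rule closed_subgroup_eq_torus[OF H(1,2)])
      fix m :: "int^'n" assume m: "m \<noteq> 0"
      show "\<exists>g. tor g \<in> H \<and> dot m g \<notin> \<int>"
      proof (cases "transpose A *v m = m")
        case True
        then show ?thesis using l m H(3) unfolding moves_invariant_characters_def by blast
      next
        case False
        then have "transpose A *v m - m \<noteq> 0" by simp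
        then obtain x where x: "dot (transpose A *v m - m) x = 1 / 2" by (rule dot_eq_half)
        have "dot m (of_int_mat A *v x - x) \<notin> \<int>" unfolding dotM x by (rule half_notin_Ints)
        moreover have "tor (of_int_mat A *v x - x) \<in> H" using H(3) unfolding M_eq by blast
        ultimately show ?thesis by blast
      qed
    qed
    have "subgroup (torus :: (complex^'n) set) torus_group"
      using group.subgroup_self[of "torus_group :: (complex^'n) monoid"] comm_group_torus_group
      by (auto simp: comm_group_def torus_group_def)
    moreover have "insert (tor l) M \<subseteq> torus" unfolding M_eq by auto
    ultimately show "closed_subgroup_generated (insert (tor l) M) = torus"
      unfolding closed_subgroup_generated_def using eq closedin_subtopology_refl by auto
  qed
qed

text \<open>The excluded points lie on countably many affine hyperplanes, a null set.\<close>

lemma moves_invariant_characters_dense: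
  fixes A :: "int^'n^'n"
  assumes "open U" "U \<noteq> {}"
  shows "\<exists>l\<in>U. moves_invariant_characters A l"
proof -
  define Z where "Z = (\<Union>(m, c)\<in>{m. m \<noteq> 0} \<times> UNIV.
      {x :: real^'n. of_int_vec (m :: int^'n) \<bullet> x = real_of_int c})"
  have "negligible Z"
    unfolding Z_def
  proof (rule negligible_countable_Union)
    show "countable ((\<lambda>(m, c). {x :: real^'n. of_int_vec m \<bullet> x = real_of_int c}) ` ({m :: int^'n. m \<noteq> 0} \<times> UNIV))"
      by (rule countable_image[OF countableI_type])
  qed (auto intro!: negligible_hyperplane)
  then have "\<not> U \<subseteq> Z"
    using open_not_negligible[OF assms] negligible_subset by blast
  then obtain l where l: "l \<in> U" "l \<notin> Z" by blast
  have "moves_invariant_characters A l"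
    using l(2) unfolding moves_invariant_characters_def Z_def by (auto simp: dot_inner elim!: Ints_cases)
  with l(1) show ?thesis by blast
qed

section \<open>Unimodular factors obstruct strong transitivity\<close>

lemma dot_pmat_transpose:
  "dot (pmat p (transpose A) *v m) x = dot m (pmat (map_poly of_int p) (of_int_mat A) *v x)"
proof (induction p arbitrary: x)
  case (pCons a p)
  have "dot (pmat (pCons a p) (transpose A) *v m) x =
      of_int a * dot m x + dot (pmat p (transpose A) *v m) (of_int_mat A *v x)"
    by (simp only: pmat_vec_pCons dot_add_left dot_smult_left dot_transpose)
  also have "\<dots> = dot m (of_int a *\<^sub>R x + of_int_mat A *v (pmat (map_poly of_int p) (of_int_mat A) *v x))"
    by (simp only: pCons.IH dot_add dot_scaleR pmat_vec_commute)
  finally show ?case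
    by (simp only: map_poly_pCons of_int_0 pmat_vec_pCons scalar_mult_eq_scaleR)
qed simp

text \<open>Let \<open>M\<close> be the lattice of integer vectors killed by \<open>p(B)\<close>. With \<open>p = (x - 1) u + p(1)\<close> the point
\<open>y = u(A) l / p(1)\<close> satisfies \<open>A y + l = y + p(A) l / p(1)\<close>, so the characters in \<open>M\<close> regard \<open>y\<close> as a fixed
point. As the constant coefficient of \<open>p\<close> is a unit, \<open>B\<close> maps \<open>M\<close> onto itself; hence the characters in
\<open>M\<close> agree at \<open>y\<close> and at all its iterated preimages.\<close>

lemma not_strongly_transitive_if_unimodular:
  fixes A :: "int^'n^'n"
  assumes T: "torus_affine A l T" and p: "unimodular_poly p" "p dvd charpoly A" "poly p 1 \<noteq> 0"
  shows "\<not> strongly_transitive_on torus T"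
proof
  assume st: "strongly_transitive_on torus T"
  let ?B = "transpose A" and ?R = "of_int_mat A :: real^'n^'n"
  let ?P = "\<lambda>f. pmat (map_poly of_int f) ?R"
  define M where "M = {m. pmat p ?B *v m = 0}"
  have "degree p > 0" using p(1) by (simp add: unimodular_poly_def)
  then obtain m where m: "m \<noteq> 0" "pmat p ?B *v m = 0"
    using integer_eigen_kernel[OF _ p(2)] by metis
  then have "m \<in> M" by (simp add: M_def)
  define z where "z = (1 / real_of_int (poly p 1)) *\<^sub>R l"
  define u where "u = synthetic_div p 1"
  have p_eq: "p = [:-1, 1:] * u + [:poly p 1:]"
    unfolding u_def by (rule synthetic_div_correct'[symmetric])
  define y where "y = ?P u *v z"
  \<comment> \<open>As seen by the characters in \<open>M\<close>, the point \<open>y\<close> is fixed.\<close>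
  have fixed: "dot m' (lift_map A l y) = dot m' y" if "m' \<in> M" for m'
  proof -
    have "0 = dot (pmat p ?B *v m') z" using that by (simp add: M_def)
    also have "pmat p ?B *v m' = ?B *v (pmat u ?B *v m') - pmat u ?B *v m' + poly p 1 *s m'"
      by (subst p_eq) (simp add: pmat_vec_add pmat_vec_mult pmat_vec_pCons del: mult_pCons_left transpose_matrix_vector)
    also have "dot \<dots> z = dot m' (?R *v y) - dot m' y + of_int (poly p 1) * dot m' z"
      by (simp only: dot_add_left dot_diff_left dot_smult_left dot_transpose dot_pmat_transpose y_def pmat_vec_commute)
    also have "of_int (poly p 1) * dot m' z = dot m' l"
      using p(3) by (simp add: z_def dot_scaleR)
    finally show ?thesis by (simp add: dot_add)
  qed
  obtain c q where c: "p = pCons c q" by (cases p) auto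
  have c1: "c * c = 1" using p(1) by (auto simp: c unimodular_poly_def)
  \<comment> \<open>The matrix \<open>B\<close> maps \<open>M\<close> onto itself: solve \<open>p(B) m' = 0\<close> for the constant term.\<close>
  have pull: "\<exists>m''\<in>M. m' = ?B *v m''" if "m' \<in> M" for m'
  proof
    let ?m = "(- c) *s (pmat q ?B *v m')"
    have "pmat p ?B *v ?m = (- c) *s (pmat q ?B *v (pmat p ?B *v m'))"
      by (simp only: scalar_commute pmat_vec_mult')
    then show "?m \<in> M" using that by (simp add: M_def)
    have "c *s (c *s m' + ?B *v (pmat q ?B *v m')) = 0"
      using that unfolding M_def c pmat_vec_pCons by simp
    then have "m' + c *s (?B *v (pmat q ?B *v m')) = 0"
      by (simp add: vector_add_ldistrib vector_smult_assoc c1 del: transpose_matrix_vector)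
    moreover have "?B *v ?m = - (c *s (?B *v (pmat q ?B *v m')))"
      unfolding scalar_commute by (simp add: vec_eq_iff del: transpose_matrix_vector)
    ultimately show "m' = ?B *v ?m" by (metis eq_neg_iff_add_eq_0)
  qed
  have descend: "\<forall>m'\<in>M. dot m' x - dot m' y \<in> \<int>" if "\<forall>m'\<in>M. dot m' (lift_map A l x) - dot m' y \<in> \<int>" for x
  proof
    fix m' assume "m' \<in> M"
    then obtain m'' where m'': "m'' \<in> M" "m' = ?B *v m''" using pull by blast
    have "dot m' v = dot m'' (lift_map A l v) - dot m'' l" for v
      unfolding m''(2) dot_transpose dot_add by simp
    from this[of x] this[of y] have "dot m' x - dot m' y = dot m'' (lift_map A l x) - dot m'' y"
      using fixed[OF m''(1)] by linarith
    then show "dot m' x - dot m' y \<in> \<int>" using that m''(1) by simp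
  qed
  have back_iter: "\<forall>m'\<in>M. dot m' x - dot m' y \<in> \<int>"
    if "\<forall>m'\<in>M. dot m' ((lift_map A l ^^ i) x) - dot m' y \<in> \<int>" for x i
    using that by (induction i) (use descend in auto)
  define V where "V = {t \<in> torus. torus_char m t \<noteq> ec (dot m y)}"
  have "openin (top_of_set torus) V" "V \<noteq> {}"
    unfolding V_def by (rule openin_torus_char_neq, rule torus_char_neq_nonempty[OF m(1)])
  then obtain N where "(\<Union>i\<le>N. (T ^^ i) ` V) = torus"
    using st unfolding strongly_transitive_on_def by blast
  then obtain i t where it: "t \<in> V" "tor y = (T ^^ i) t"
    using tor_in_torus[of y] by blast
  then obtain x where x: "t = tor x" unfolding V_def using torusE by blast
  have "int_vec ((lift_map A l ^^ i) x - y)"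
    using it(2) unfolding x torus_affine_iterate[OF T] by (metis tor_eq_iff)
  then have "\<forall>m'\<in>M. dot m' ((lift_map A l ^^ i) x) - dot m' y \<in> \<int>"
    using dot_int_vec by (metis dot_diff)
  then have "dot m x - dot m y \<in> \<int>" using back_iter \<open>m \<in> M\<close> by blast
  then show False using it(1) unfolding V_def x torus_char_tor ec_eq_iff[symmetric] by (simp add: torus_char_tor)
qed

section \<open>Conjugacy\<close>

text \<open>The conjugating homeomorphism is the translation by a solution \<open>c\<close> of \<open>(1 - A) c = l\<close>.\<close>

lemma conjugate_if_no_eigenvalue_1:
  fixes A :: "int^'n^'n"
  assumes T: "torus_affine A l T" and "poly (charpoly A) 1 \<noteq> 0"
  shows "conjugate_on torus T (torus_endo A)"
proof -
  have "ipoly (charpoly A) (of_int 1 :: real) \<noteq> 0"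
    using assms(2) unfolding ipoly_of_int by simp
  then have "det (mat 1 - of_int_mat A :: real^'n^'n) \<noteq> 0" by (simp add: ipoly_charpoly)
  then have "invertible (mat 1 - of_int_mat A :: real^'n^'n)" by (simp only: invertible_det_nz not_False_eq_True)
  then obtain Q :: "real^'n^'n" where Q: "(mat 1 - of_int_mat A) ** Q = mat 1"
    unfolding invertible_def by blast
  define c where "c = Q *v l"
  have "(mat 1 - of_int_mat A) *v c = l"
    unfolding c_def matrix_vector_mul_assoc Q by simp
  then have c: "c - of_int_mat A *v c = l" by (simp add: matrix_vector_mult_diff_rdistrib)
  have cont: "continuous_on torus (\<lambda>t. \<chi> i. tor b $ i * t $ i)" for b :: "real^'n"
    by (intro continuous_intros)
  have tr: "(\<chi> i. tor b $ i * tor x $ i) = tor (b + x)" for b x :: "real^'n"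
    using tor_mult[of b x] by (simp add: torus_group_def)
  have img: "(\<lambda>t. \<chi> i. tor b $ i * t $ i) ` torus \<subseteq> torus" for b :: "real^'n"
  proof (rule image_subsetI)
    fix t :: "complex^'n" assume "t \<in> torus"
    then obtain x where "t = tor x" by (rule torusE)
    then show "(\<chi> i. tor b $ i * t $ i) \<in> torus" by (simp only: tr tor_in_torus)
  qed
  show ?thesis
    unfolding conjugate_on_def
  proof (intro exI conjI ballI)
    show "homeomorphism torus torus (\<lambda>t. \<chi> i. tor c $ i * t $ i) (\<lambda>t. \<chi> i. tor (- c) $ i * t $ i)"
    proof (rule homeomorphismI[OF cont cont img img])
      fix t :: "complex^'n" assume "t \<in> torus"
      then obtain x where "t = tor x" by (rule torusE)
      then show "(\<chi> i. tor (- c) $ i * (\<chi> i. tor c $ i * t $ i) $ i) = t"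
        "(\<chi> i. tor c $ i * (\<chi> i. tor (- c) $ i * t $ i) $ i) = t"
        by (simp_all only: tr) simp_all
    qed
    fix t :: "complex^'n" assume "t \<in> torus"
    then obtain x where x: "t = tor x" by (rule torusE)
    have "of_int_mat A *v x + l = c + of_int_mat A *v (- c + x)"
      using c by (simp add: uminus_add_conv_diff matrix_vector_mult_diff_distrib algebra_simps)
    then show "T t = (\<chi> i. tor c $ i * torus_endo A (\<chi> i. tor (- c) $ i * t $ i) $ i)"
      using T by (simp only: x tr torus_endo_tor torus_affine_def)
  qed
qed

section \<open>The classification of affine maps\<close>

lemma eigenvalue_1_iff_invariant_character:
  fixes A :: "int^'n^'n"
  shows "poly (charpoly A) 1 = 0 \<longleftrightarrow> (\<exists>m. m \<noteq> 0 \<and> transpose A *v m = m)"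
proof
  assume "poly (charpoly A) 1 = 0"
  then have "[:- 1, 1:] dvd charpoly A" by (simp add: poly_eq_0_iff_dvd)
  then obtain m where "m \<noteq> 0" "pmat [:- 1, 1:] (transpose A) *v m = 0"
    using integer_eigen_kernel[of "[:- 1, 1:]" A] by auto
  moreover have "pmat [:- 1, 1:] (transpose A) *v m = transpose A *v m - m"
    by (simp add: pmat_vec_pCons vec_eq_iff del: transpose_matrix_vector)
  ultimately show "\<exists>m. m \<noteq> 0 \<and> transpose A *v m = m"
    by (auto simp del: transpose_matrix_vector)
next
  assume "\<exists>m. m \<noteq> 0 \<and> transpose A *v m = m"
  then obtain m where m: "m \<noteq> 0" "transpose A *v m = m" by blast
  have "of_int_mat (transpose A) *v of_int_vec m = (1 :: complex) *s of_int_vec m"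
    by (simp add: of_int_vec_mult[symmetric] m(2) del: transpose_matrix_vector)
  then have "ipoly (charpoly A) (of_int 1 :: complex) = 0"
    using m(1) by (subst charpoly_root_iff) (auto intro!: exI[of _ "of_int_vec m"])
  then show "poly (charpoly A) 1 = 0" unfolding ipoly_of_int by simp
qed

theorem theorem4p3:
  fixes A :: "int^'n^'n" and k :: nat and g :: "int poly"
  assumes "det A \<noteq> 0"
    and "k = Polynomial.order 1 (charpoly A)"
    and "charpoly A = [:1, -1:] ^ k * g"
  shows
    "((\<nexists>p. unimodular_poly p \<and> p dvd charpoly A) \<longrightarrow>
        (\<forall>T. affine_map_of A T \<and> local_homeomorphism_on torus T \<longrightarrow>
           exact_on torus T \<and> conjugate_on torus T (torus_endo A)))
     \<and>
     (k \<ge> 1 \<and> (\<nexists>p. unimodular_poly p \<and> p dvd g) \<longrightarrow>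
        (let S = {\<mu> \<in> torus. closed_subgroup_generated
                   (insert \<mu> {inv\<^bsub>torus_group\<^esub> x \<otimes>\<^bsub>torus_group\<^esub> torus_endo A x | x. x \<in> torus}) = torus}
         in S \<subset> torus \<and> top_of_set torus closure_of S = torus \<and>
            (\<forall>\<mu>\<in>torus. strongly_transitive_on torus (\<lambda>x. \<mu> \<otimes>\<^bsub>torus_group\<^esub> torus_endo A x)
                         \<longleftrightarrow> \<mu> \<in> S)) \<and>
        (\<forall>T. affine_map_of A T \<and> local_homeomorphism_on torus T \<longrightarrow> \<not> exact_on torus T))
     \<and>
     ((\<exists>p. unimodular_poly p \<and> p dvd g) \<longrightarrow>
        (\<forall>T. affine_map_of A T \<and> local_homeomorphism_on torus T \<longrightarrow>
           \<not> strongly_transitive_on torus T))"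
proof -
  have nz: "charpoly A \<noteq> 0" using lead_coeff_charpoly[of A] by auto
  have minus: "[:1, -1:] = - [:- 1, 1 :: int:]" by simp
  \<comment> \<open>The exponent \<open>k\<close> is the full multiplicity of 1, so none of it is left in \<open>g\<close>.\<close>
  have g1: "poly g 1 \<noteq> 0"
  proof
    assume "poly g 1 = 0"
    then have "[:- 1, 1:] dvd g" by (simp add: poly_eq_0_iff_dvd)
    then have "[:1, -1:] dvd g" by (metis minus minus_dvd_iff)
    then have "[:1, -1:] ^ Suc k dvd charpoly A"
      unfolding assms(3) power_Suc2 by (intro mult_dvd_mono dvd_refl)
    moreover have "[:- 1, 1:] dvd [:1, -1 :: int:]"
      by (metis minus dvd_minus_iff dvd_refl)
    then have "[:- 1, 1:] ^ Suc k dvd [:1, -1 :: int:] ^ Suc k" by (rule dvd_power_same)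
    ultimately have "[:- 1, 1:] ^ Suc k dvd charpoly A" by (rule dvd_trans[rotated])
    then show False using order_2[OF nz, of 1] assms(2) by simp
  qed
  obtain R :: "real^'n^'n" where R: "\<And>x. of_int_mat A *v (R *v x) = x" "\<And>x. R *v (of_int_mat A *v x) = x"
    using real_inverse_of_int_mat[OF assms(1)] by blast
  have part1: "exact_on torus T \<and> conjugate_on torus T (torus_endo A)"
    if none: "\<nexists>p. unimodular_poly p \<and> p dvd charpoly A" and T: "affine_map_of A T" for T
  proof -
    obtain l where l: "torus_affine A l T" using T affine_map_of_iff by blast
    have none': "\<nexists>p. unimodular_poly p \<and> p dvd g"
      using none unfolding assms(3) by (metis dvd_mult)
    have "unimodular_poly [:- 1, 1:]" by (simp add: unimodular_poly_def)
    then have ne: "poly (charpoly A) 1 \<noteq> 0"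
      using none by (auto simp: poly_eq_0_iff_dvd)
    \<comment> \<open>As 1 is not an eigenvalue, \<open>B - 1\<close> is injective, so no nontrivial character is unipotent.\<close>
    have "(((\<lambda>v. transpose A *v v - v) ^^ r) m) \<noteq> 0" if "m \<noteq> 0" for m :: "int^'n" and r
    proof (induction r)
      case (Suc r)
      then show ?case
        using ne unfolding eigenvalue_1_iff_invariant_character by (auto simp del: transpose_matrix_vector)
    qed (use that in simp)
    then have "exact_on torus T"
      using exact_if_characters_detected[OF R(1) l]
        character_detected_by_preimages_of_0[OF assms(3) none' R] by blast
    then show ?thesis using conjugate_if_no_eigenvalue_1[OF l ne] by blast
  qed
  have part3: "\<not> strongly_transitive_on torus T"
    if p: "unimodular_poly p" "p dvd g" and T: "affine_map_of A T" for T p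
  proof -
    obtain l where l: "torus_affine A l T" using T affine_map_of_iff by blast
    have "p dvd charpoly A" using p(2) unfolding assms(3) by (rule dvd_mult)
    moreover have "poly p 1 \<noteq> 0" using g1 p(2) by (auto simp: dvd_def)
    ultimately show ?thesis using not_strongly_transitive_if_unimodular[OF l p(1)] by blast
  qed
  define S where "S = {\<mu> \<in> torus. closed_subgroup_generated
      (insert \<mu> {inv\<^bsub>torus_group\<^esub> x \<otimes>\<^bsub>torus_group\<^esub> torus_endo A x | x. x \<in> torus}) = torus}"
  have S_iff: "tor l \<in> S \<longleftrightarrow> moves_invariant_characters A l" for l
    unfolding S_def by (simp add: closed_subgroup_generated_eq_torus_iff)
  have part2: "S \<subset> torus \<and> top_of_set torus closure_of S = torus \<and>
      (\<forall>\<mu>\<in>torus. strongly_transitive_on torus (\<lambda>x. \<mu> \<otimes>\<^bsub>torus_group\<^esub> torus_endo A x) \<longleftrightarrow> \<mu> \<in> S) \<and>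
      (\<forall>T. affine_map_of A T \<longrightarrow> \<not> exact_on torus T)"
    if k: "k \<ge> 1" and none: "\<nexists>p. unimodular_poly p \<and> p dvd g"
  proof -
    have "poly (charpoly A) 1 = 0"
      using k by (simp add: assms(3))
    then obtain m where m: "m \<noteq> 0" "transpose A *v m = m"
      unfolding eigenvalue_1_iff_invariant_character by blast
    have "tor 0 \<notin> S"
      unfolding S_iff moves_invariant_characters_def using m by (auto simp del: transpose_matrix_vector)
    moreover have "S \<subseteq> torus" unfolding S_def by blast
    ultimately have proper: "S \<subset> torus" using tor_in_torus by blast
    have dense: "torus \<subseteq> top_of_set torus closure_of S"
    proof
      fix t :: "complex^'n" assume t: "t \<in> torus"
      show "t \<in> top_of_set torus closure_of S"
        unfolding in_closure_of
      proof (intro conjI allI impI)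
        fix V assume V: "t \<in> V \<and> openin (top_of_set torus) V"
        then obtain W where W: "open W" "V = torus \<inter> W" by (auto simp: openin_open)
        obtain x where x: "t = tor x" using t by (rule torusE)
        have "open (tor -` W)"
          using open_vimage[OF W(1) continuous_on_tor[OF continuous_on_id]] by simp
        moreover have "x \<in> tor -` W" using V W(2) x by auto
        ultimately obtain l where "l \<in> tor -` W" "moves_invariant_characters A l"
          using moves_invariant_characters_dense by blast
        then show "\<exists>y. y \<in> S \<and> y \<in> V"
          using S_iff W(2) by (intro exI[of _ "tor l"]) simp
      qed (use t in simp)
    qed
    have st: "strongly_transitive_on torus (\<lambda>x. \<mu> \<otimes>\<^bsub>torus_group\<^esub> torus_endo A x) \<longleftrightarrow> \<mu> \<in> S"
      if \<mu>: "\<mu> \<in> torus" for \<mu> :: "complex^'n"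
    proof -
      obtain l where l: "\<mu> = tor l" using \<mu> by (rule torusE)
      have T: "torus_affine A l (\<lambda>x. \<mu> \<otimes>\<^bsub>torus_group\<^esub> torus_endo A x)"
        by (simp add: torus_affine_def l torus_endo_tor tor_mult add.commute)
      show ?thesis
        unfolding l S_iff
        using strongly_transitive_if_moves_invariant_characters[OF assms(3) none R _ T]
          moves_invariant_characters_if_strongly_transitive[OF T] unfolding l by blast
    qed
    have "\<not> exact_on torus T" if "affine_map_of A T" for T
      using that not_exact_if_invariant_character[OF _ m] affine_map_of_iff by blast
    moreover have "top_of_set torus closure_of S = torus"
      using dense closure_of_subset_topspace[of "top_of_set torus" S] by auto
    ultimately show ?thesis using proper st by blast
  qed
  show ?thesis
    unfolding Let_def S_def[symmetric] using part1 part2 part3 by blast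
qed

end
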